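(* Let $a:\mathbb{R}\to\mathbb{R}$ be continuous and non-decreasing with $a(t)\ge\sigma$ for all $t\in\mathbb{R}$, for some constant $\sigma>0$; let $b>0$, $\lambda>0$ and let $N\ge0$ be an integer. If $a(0)N^2<\lambda\le a(0)(N+1)^2$, then there are $2N+1$ equilibria of the equation $$u_t=a(\|u_x\|^2)u_{xx}+\lambda u-bu^3,\quad x\in(0,\pi),\ t>0;\qquad u(0,t)=u(\pi,t)=0,$$ namely $\{0\}\cup\{\phi^{\pm}_{j,b}: j=1,\dots,N\}$, where $\phi^+_{j,b}$ and $\phi^-_{j,b}$ have $j+1$ zeros in $[0,\pi]$ and $\phi^-_{j,b}=-\phi^+_{j,b}$.
   Context: $\|u_x\|^2=\int_0^\pi|u_x(x)|^2dx$. An equilibrium is a time-independent solution, i.e. a function $u\in H^2(0,\pi)\cap H^1_0(0,\pi)$ with $a(\|u_x\|^2)u_{xx}+\lambda u-bu^3=0$ in $(0,\pi)$ and $u(0)=u(\pi)=0$. *)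

theory Defs
  imports "HOL-Analysis.Analysis"
begin

abbreviation interval_measure_0_pi :: "real measure" where
  "interval_measure_0_pi \<equiv> lebesgue_on {0<..<pi}"

definition L2 :: "(real \<Rightarrow> real) set" where
  "L2 = {u. u \<in> borel_measurable interval_measure_0_pi \<and>
            integrable interval_measure_0_pi (\<lambda>x. (u x)\<^sup>2)}"

text \<open>The space of smooth functions with compact support in the open interval from 0 to pi.\<close>

definition test_functions :: "(real \<Rightarrow> real) set" where
  "test_functions = {\<phi>. (\<forall>k. (deriv ^^ k) \<phi> differentiable_on UNIV) \<and>
     (\<exists>K. compact K \<and> K \<subseteq> {0<..<pi} \<and> (\<forall>x. x \<notin> K \<longrightarrow> \<phi> x = 0))}"

text \<open>Weak derivatives within \<open>L2\<close>: both the function and its derivative are required to be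
  square integrable, so that all integrals below exist.\<close>

definition has_weak_deriv :: "(real \<Rightarrow> real) \<Rightarrow> (real \<Rightarrow> real) \<Rightarrow> bool" where
  "has_weak_deriv u v \<longleftrightarrow> u \<in> L2 \<and> v \<in> L2 \<and>
     (\<forall>\<phi>\<in>test_functions.
        (LINT x|interval_measure_0_pi. u x * deriv \<phi> x) =
        - (LINT x|interval_measure_0_pi. v x * \<phi> x))"

definition H2 :: "(real \<Rightarrow> real) set" where
  "H2 = {u. \<exists>ux uxx. has_weak_deriv u ux \<and> has_weak_deriv ux uxx}"

text \<open>The closure of the test functions in the \<open>H1\<close> norm.\<close>

definition H10 :: "(real \<Rightarrow> real) set" where
  "H10 = {u. \<exists>ux. has_weak_deriv u ux \<and>
     (\<forall>\<epsilon>>0. \<exists>\<phi>\<in>test_functions.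
        (LINT x|interval_measure_0_pi. (u x - \<phi> x)\<^sup>2) +
        (LINT x|interval_measure_0_pi. (ux x - deriv \<phi> x)\<^sup>2) < \<epsilon>)}"

text \<open>Elements of \<open>H2 \<inter> H10\<close> are classes of functions modulo equality almost everywhere on the
  interval. To count them, and to speak of their boundary values and zeros, each class is
  represented by its unique representative that is continuous on \<open>{0..pi}\<close>, extended by 0 to the
  whole line. The weak derivatives \<open>ux\<close> and \<open>uxx\<close> are unique up to null sets, so the choice of
  witnesses is immaterial.\<close>

definition equilibria :: "(real \<Rightarrow> real) \<Rightarrow> real \<Rightarrow> real \<Rightarrow> (real \<Rightarrow> real) set" where
  "equilibria a b lam = {u \<in> H2 \<inter> H10.
     continuous_on {0..pi} u \<and> (\<forall>x. x \<notin> {0..pi} \<longrightarrow> u x = 0) \<and>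
     u 0 = 0 \<and> u pi = 0 \<and>
     (\<exists>ux uxx. has_weak_deriv u ux \<and> has_weak_deriv ux uxx \<and>
        (AE x in interval_measure_0_pi.
           a (LINT y|interval_measure_0_pi. \<bar>ux y\<bar>\<^sup>2) * uxx x + lam * u x - b * (u x) ^ 3 = 0))}"

end

(* A weak equilibrium u with a(|u_x|^2) = A is a classical solution of A u'' + lam u - b u^3 = 0
   with Dirichlet conditions (du Bois-Reymond lemma). For fixed A the nonzero solutions are
   u = +-m sin(theta), where mu = b m^2 / 2 < lam / 2 and theta' = sqrt((lam - mu (1 + sin^2 theta)) / A),
   theta(0) = 0; the boundary condition at pi says that theta(pi) = j pi for some j >= 1, and u then has
   j + 1 zeros. For given j this condition determines A = A_j(mu), a strictly decreasing function of the
   amplitude parameter mu, with A_j(0) = lam / j^2 and A_j(mu) -> 0 as mu -> lam / 2, while the Dirichlet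
   energy D_j(mu) of u is increasing with D_j(0) = 0. Since a is non-decreasing, the consistency condition
   A_j(mu) = a(D_j(mu)) has a solution iff a(0) j^2 < lam, and the solution is unique. *)

theory Submission
  imports Defs
begin

text \<open>In the variable \<open>u\<close> the integral for the length of an arch is singular at
  the turning points, and an oscillating solution would have to be glued together there. The angle
  removes both difficulties: in the law of conservation of energy the factor cos^2 \<theta> splits
  off from both sides, and what remains bounds \<theta>' away from zero. So \<theta> is a global
  increasing function, and the zeros of \<open>u\<close> are the points where it meets multiples of
  \<open>pi\<close>. Conversely, the energy of a given solution fixes its parameter \<mu>, and
  uniqueness for the initial value problem at 0 identifies the solution with a profile up to sign.
  The limit of \<open>A_j\<close> at \<open>lam / 2\<close> reflects the logarithmically slow motion
  near the constant solutions \<open>u^2 = lam / b\<close>. On the weak side the work lies in a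
  sufficient supply of test functions: they must detect functions almost everywhere, and they must
  approximate a solution in the \<open>H1\<close> norm. Derivatives are taken within the closed
  interval because the counted representatives are extended by 0 and, unless they vanish, have
  corners at the two ends.\<close>

definition classical_solution :: "real \<Rightarrow> real \<Rightarrow> real \<Rightarrow> (real \<Rightarrow> real) \<Rightarrow> (real \<Rightarrow> real) \<Rightarrow> bool" where
  "classical_solution A b lam u v \<longleftrightarrow> (\<forall>x\<in>{0..pi}.
     (u has_real_derivative v x) (at x within {0..pi}) \<and>
     (v has_real_derivative - (lam * u x - b * u x ^ 3) / A) (at x within {0..pi}))"

section \<open>The time map\<close>

text \<open>Taking the open interval to be the whole line gives two-sided derivatives everywhere.
  The inversion that produces the phase and the primitives of test functions rely on that.\<close>

lemma exists_antiderivative: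
  fixes f :: "real \<Rightarrow> real"
  assumes "continuous_on UNIV f"
  obtains F where "F 0 = 0" "\<And>x. (F has_real_derivative f x) (at x)"
proof -
  have "\<exists>F. \<forall>x::real. -\<infinity> < ereal x \<longrightarrow> ereal x < \<infinity> \<longrightarrow> (F has_vector_derivative f x) (at x)"
    by (rule einterval_antiderivative) (use assms in \<open>auto simp: continuous_on_eq_continuous_at\<close>)
  then obtain F where F: "\<And>x. (F has_real_derivative f x) (at x)"
    by (auto simp: has_real_derivative_iff_has_vector_derivative)
  show ?thesis
    by (rule that[of "\<lambda>x. F x - F 0"]) (auto intro!: derivative_eq_intros F)
qed

locale cubic_nonlinearity =
  fixes lam b :: real
  assumes lam_pos: "lam > 0" and b_pos: "b > 0"
begin

text \<open>With \<open>u = m * sin \<theta>\<close> and \<open>\<mu> = b * m\<^sup>2 / 2\<close>, conservation of energy becomes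
  \<open>\<theta>'\<^sup>2 = Q \<mu> \<theta> / A\<close>; the bound \<open>\<mu> < lam / 2\<close> keeps \<open>Q\<close> positive.\<close>

definition Q :: "real \<Rightarrow> real \<Rightarrow> real" where
  "Q \<mu> t = lam - \<mu> * (1 + (sin t)\<^sup>2)"

text \<open>In terms of the complete elliptic integral of the first kind this is
  \<open>2 * K(k) / sqrt (lam - \<mu>)\<close> with \<open>k^2 = \<mu> / (lam - \<mu>)\<close>;
  times \<open>sqrt A\<close> it is the length of one arch.\<close>

definition half_period :: "real \<Rightarrow> real" where
  "half_period \<mu> = integral {-(pi/2)..pi/2} (\<lambda>t. 1 / sqrt (Q \<mu> t))"

text \<open>Up to the factor \<open>2 * \<mu> / (b * sqrt A)\<close> this is the integral of
  \<open>u_x\<close> against \<open>du\<close> over half an oscillation, that is, one arch's share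
  of the Dirichlet energy.\<close>

definition half_action :: "real \<Rightarrow> real" where
  "half_action \<mu> = integral {-(pi/2)..pi/2} (\<lambda>t. (cos t)\<^sup>2 * sqrt (Q \<mu> t))"

text \<open>The Dirichlet energy and the diffusion coefficient that are forced on a solution consisting of
  \<open>j\<close> arches with parameter \<open>\<mu>\<close> on an interval of length \<open>pi\<close>.\<close>

definition dirichlet :: "nat \<Rightarrow> real \<Rightarrow> real" where
  "dirichlet j \<mu> = (real j)\<^sup>2 / pi * half_period \<mu> * (2 * \<mu> / b * half_action \<mu>)"

definition diffusivity :: "nat \<Rightarrow> real \<Rightarrow> real" where
  "diffusivity j \<mu> = (pi / (real j * half_period \<mu>))\<^sup>2"

lemma Q_ge: "0 \<le> \<mu> \<Longrightarrow> Q \<mu> t \<ge> lam - 2 * \<mu>"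
proof -
  assume "0 \<le> \<mu>"
  then have "\<mu> * (1 + (sin t)\<^sup>2) \<le> \<mu> * 2"
    by (intro mult_left_mono) (auto simp: abs_square_le_1)
  then show ?thesis by (simp add: Q_def)
qed

lemma Q_pos: "0 \<le> \<mu> \<Longrightarrow> \<mu> < lam / 2 \<Longrightarrow> Q \<mu> t > 0"
  using Q_ge[of \<mu> t] by simp

lemma Q_le: "0 \<le> \<mu> \<Longrightarrow> Q \<mu> t \<le> lam"
  by (simp add: Q_def)

lemma continuous_Q: "continuous_on T (Q \<mu>)"
  unfolding Q_def by (intro continuous_intros)

lemma continuous_inverse_sqrt_Q:
  assumes "0 \<le> \<mu>" "\<mu> < lam / 2" shows "continuous_on T (\<lambda>t. 1 / sqrt (Q \<mu> t))"
  using Q_pos[OF assms] by (intro continuous_intros continuous_Q) (auto simp: less_imp_neq[symmetric])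

lemma continuous_action_integrand: "continuous_on T (\<lambda>t. (cos t)\<^sup>2 * sqrt (Q \<mu> t))"
  by (intro continuous_intros continuous_Q)

text \<open>The increment of \<open>H\<close> over a shift by \<open>pi\<close> has zero derivative,
  so it can be read off on any window. The window from \<open>-(pi/2)\<close> to \<open>pi/2\<close>
  is preferred because \<open>cos\<close> is nonnegative there, as the later substitution
  requires.\<close>

lemma antiderivative_periodic:
  assumes H: "\<And>t. (H has_real_derivative h t) (at t)" and "H 0 = 0" and per: "\<And>t. h (t + pi) = h t"
  shows "H (real k * pi) = real k * integral {-(pi/2)..pi/2} h"
proof -
  define G where "G t = H (t + pi) - H t" for t
  have "(G has_real_derivative h (t + pi) * 1 - h t) (at t)" for t
    unfolding G_def by (intro DERIV_diff H DERIV_chain2[OF H]) (auto intro!: derivative_eq_intros)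
  then have G: "G t = G s" for s t
    by (intro DERIV_const_ratio_const2 DERIV_isconst_all) (simp add: per)
  have "(h has_integral H (pi/2) - H (-(pi/2))) {-(pi/2)..pi/2}"
    by (intro fundamental_theorem_of_calculus)
       (auto simp: has_real_derivative_iff_has_vector_derivative[symmetric] intro: has_field_derivative_at_within[OF H])
  then have "integral {-(pi/2)..pi/2} h = G (-(pi/2))" by (simp add: G_def integral_unique)
  then have step: "H (t + pi) = H t + integral {-(pi/2)..pi/2} h" for t
    using G[of t "-(pi/2)"] by (simp add: G_def)
  show ?thesis
  proof (induction k)
    case (Suc k)
    have "real (Suc k) * pi = real k * pi + pi" by (simp add: algebra_simps)
    then show ?case using Suc step[of "real k * pi"] by (simp add: algebra_simps)
  qed (simp add: assms)
qed

text \<open>A predicate instead of a chosen function: later results hold for any phase, so a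
  solution can be represented by whichever phase is at hand. The last clause records where the angle
  reaches the zeros of the sine.\<close>

definition is_phase :: "real \<Rightarrow> real \<Rightarrow> (real \<Rightarrow> real) \<Rightarrow> bool" where
  "is_phase A \<mu> \<theta> \<longleftrightarrow> \<theta> 0 = 0 \<and> (\<forall>x. (\<theta> has_real_derivative sqrt (Q \<mu> (\<theta> x) / A)) (at x)) \<and>
     (\<forall>k::nat. \<theta> (real k * (sqrt A * half_period \<mu>)) = real k * pi)"

text \<open>The equation for \<theta> is separable: position as a function of the angle is a plain
  integral, and \<theta> is its inverse.\<close>

lemma phase_exists:
  assumes A: "A > 0" and \<mu>: "0 \<le> \<mu>" "\<mu> < lam / 2"
  shows "\<exists>\<theta>. is_phase A \<mu> \<theta>"
proof -
  obtain X where X: "X 0 = 0" "\<And>t. (X has_real_derivative 1 / sqrt (Q \<mu> t)) (at t)"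
    using exists_antiderivative[OF continuous_inverse_sqrt_Q[OF \<mu>]] by metis
  have X\<pi>: "X (real k * pi) = real k * half_period \<mu>" for k
    unfolding half_period_def by (rule antiderivative_periodic[OF X(2,1)]) (simp add: Q_def)
  define Z where "Z t = sqrt A * X t" for t
  have Z: "(Z has_real_derivative sqrt A / sqrt (Q \<mu> t)) (at t)" for t
    unfolding Z_def using DERIV_cmult[OF X(2), of "sqrt A"] by simp
  have Zpos: "sqrt A / sqrt (Q \<mu> t) > 0" for t using A Q_pos[OF \<mu>] by simp
  have mono: "Z s < Z t" if "s < t" for s t
    using DERIV_pos_imp_increasing[OF that, of Z] Z Zpos by blast
  then have inj: "inj Z" by (metis injI linorder_neqE_linordered_idom less_irrefl)
  \<comment> \<open>A lower bound for the derivative of \<open>Z\<close>, from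
    \<open>Q \<mu> t \<le> lam\<close>. Linear growth in both directions makes \<open>Z\<close>
    onto, so the inverse lives on the whole line.\<close>
  define c where "c = sqrt A / sqrt lam"
  have c: "c > 0" using A lam_pos by (simp add: c_def)
  have cle: "c \<le> sqrt A / sqrt (Q \<mu> t)" for t
    unfolding c_def using A lam_pos Q_pos[OF \<mu>] Q_le[OF \<mu>(1)] by (intro divide_left_mono) auto
  have grow: "c * (t - s) \<le> Z t - Z s" if "s \<le> t" for s t
  proof -
    have "Z s - c * s \<le> Z t - c * t"
    proof (rule DERIV_nonneg_imp_nondecreasing[OF that])
      fix x
      have "((\<lambda>x. Z x - c * x) has_real_derivative sqrt A / sqrt (Q \<mu> x) - c) (at x)"
        by (auto intro!: derivative_eq_intros Z)
      then show "\<exists>y. ((\<lambda>x. Z x - c * x) has_real_derivative y) (at x) \<and> 0 \<le> y" using cle[of x] by force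
    qed
    then show ?thesis by (simp add: algebra_simps)
  qed
  have surj: "\<exists>t. Z t = y" for y
  proof -
    have Z0: "Z 0 = 0" by (simp add: Z_def X)
    define r where "r = \<bar>y\<bar> / c"
    have r: "0 \<le> r" "c * r = \<bar>y\<bar>" using c by (auto simp: r_def)
    have "Z (-r) \<le> y" "y \<le> Z r" using grow[of "-r" 0] grow[of 0 r] r Z0 by auto
    moreover have "isCont Z x" for x using Z DERIV_isCont by blast
    ultimately show ?thesis using IVT[of Z "-r" y r] r by auto
  qed
  define \<theta> where "\<theta> = inv Z"
  have \<theta>Z: "\<theta> (Z t) = t" for t by (simp add: \<theta>_def inj)
  have Z\<theta>: "Z (\<theta> y) = y" for y using surj[of y] \<theta>Z by metis
  have cont: "isCont \<theta> y" for y
  proof -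
    have "isCont \<theta> (Z (\<theta> y))"
      by (rule isCont_inverse_function[where f=Z and x="\<theta> y" and d=1]) (use \<theta>Z DERIV_isCont[OF Z] in auto)
    then show ?thesis by (simp add: Z\<theta>)
  qed
  have "(\<theta> has_real_derivative inverse (sqrt A / sqrt (Q \<mu> (\<theta> x)))) (at x)" for x
    by (rule DERIV_inverse_function[where f=Z and a="x-1" and b="x+1"]) (use Z Zpos[of "\<theta> x"] Z\<theta> cont in auto)
  then have "(\<theta> has_real_derivative sqrt (Q \<mu> (\<theta> x) / A)) (at x)" for x
    by (simp add: real_sqrt_divide)
  moreover have "\<theta> 0 = 0" using \<theta>Z[of 0] by (simp add: Z_def X)
  moreover have "\<theta> (real k * (sqrt A * half_period \<mu>)) = real k * pi" for k
    using \<theta>Z[of "real k * pi"] X\<pi>[of k] by (simp add: Z_def mult.left_commute)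
  ultimately show ?thesis by (auto simp: is_phase_def)
qed

lemma phase_strict_mono:
  assumes "A > 0" "0 \<le> \<mu>" "\<mu> < lam / 2" "is_phase A \<mu> \<theta>" "x < y"
  shows "\<theta> x < \<theta> y"
  using DERIV_pos_imp_increasing[OF \<open>x < y\<close>, of \<theta>] assms Q_pos unfolding is_phase_def
  by (metis divide_pos_pos real_sqrt_gt_0_iff)

text \<open>For \<open>A = 1\<close> the increasing phase takes the value 0 at 0 and
  \<open>pi\<close> at \<open>half_period \<mu>\<close>, which therefore lies to the right of
  0.\<close>

lemma half_period_pos:
  assumes \<mu>: "0 \<le> \<mu>" "\<mu> < lam / 2" shows "half_period \<mu> > 0"
proof -
  obtain \<theta> where \<theta>: "is_phase 1 \<mu> \<theta>" using phase_exists[of 1 \<mu>] \<mu> by auto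
  then have "\<theta> (half_period \<mu>) = pi" "\<theta> 0 = 0" by (auto simp: is_phase_def dest: spec[of _ "1::nat"])
  then show ?thesis
    using phase_strict_mono[OF _ \<mu> \<theta>, of "half_period \<mu>" 0] pi_gt_zero by (cases "half_period \<mu> = 0"; cases "half_period \<mu> < 0") auto
qed

section \<open>Profiles built from a phase: equation, zeros, Dirichlet energy\<close>

definition profile :: "real \<Rightarrow> (real \<Rightarrow> real) \<Rightarrow> real \<Rightarrow> real" where
  "profile \<mu> \<theta> x = sqrt (2 * \<mu> / b) * sin (\<theta> x)"

definition profile_slope :: "real \<Rightarrow> real \<Rightarrow> (real \<Rightarrow> real) \<Rightarrow> real \<Rightarrow> real" where
  "profile_slope A \<mu> \<theta> x = sqrt (2 * \<mu> / b) * (cos (\<theta> x) * sqrt (Q \<mu> (\<theta> x) / A))"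

lemma profile_solution:
  assumes A: "A > 0" and \<mu>: "0 \<le> \<mu>" "\<mu> < lam / 2" and \<theta>: "is_phase A \<mu> \<theta>"
  shows "(profile \<mu> \<theta> has_real_derivative profile_slope A \<mu> \<theta> x) (at x)"
    and "(profile_slope A \<mu> \<theta> has_real_derivative - (lam * profile \<mu> \<theta> x - b * profile \<mu> \<theta> x ^ 3) / A) (at x)"
proof -
  have d: "(\<theta> has_real_derivative sqrt (Q \<mu> (\<theta> x) / A)) (at x)" for x using \<theta> by (simp add: is_phase_def)
  show "(profile \<mu> \<theta> has_real_derivative profile_slope A \<mu> \<theta> x) (at x)"
    unfolding profile_def profile_slope_def by (auto intro!: derivative_eq_intros d)
  define m where "m = sqrt (2 * \<mu> / b)"
  \<comment> \<open>The normalisation \<open>\<mu> = b * m^2 / 2\<close> turns the cubic coefficient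
    into a multiple of \<open>m\<close>.\<close>
  have m: "b * m ^ 3 = 2 * \<mu> * m"
    using \<mu> b_pos by (simp add: m_def power3_eq_cube)
  define r where "r = sqrt (Q \<mu> (\<theta> x) / A)"
  have q: "Q \<mu> (\<theta> x) / A > 0" using A Q_pos[OF \<mu>] by simp
  then have r: "r > 0" "r * r = Q \<mu> (\<theta> x) / A" unfolding r_def by (simp, intro real_sqrt_mult_self[THEN trans] abs_of_pos)
  have Qd: "((\<lambda>x. Q \<mu> (\<theta> x) / A) has_real_derivative - (2 * \<mu> * sin (\<theta> x) * cos (\<theta> x) * r) / A) (at x)"
    unfolding Q_def using A by (auto intro!: derivative_eq_intros d simp: r_def Q_def)
  have "((\<lambda>x. sqrt (Q \<mu> (\<theta> x) / A)) has_real_derivative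
      inverse r / 2 * (- (2 * \<mu> * sin (\<theta> x) * cos (\<theta> x) * r) / A)) (at x)"
    by (rule DERIV_chain2[where f=sqrt and g="\<lambda>x. Q \<mu> (\<theta> x) / A", OF DERIV_real_sqrt[OF q, folded r_def] Qd])
  \<comment> \<open>The factor \<open>r\<close> from the derivative of \<theta> cancels the
    \<open>inverse r\<close> of the square root. In the other summand \<open>r\<close> will occur
    squared, so no square root survives in the second derivative.\<close>
  then have sd: "((\<lambda>x. sqrt (Q \<mu> (\<theta> x) / A)) has_real_derivative - (\<mu> * sin (\<theta> x) * cos (\<theta> x)) / A) (at x)"
    using r(1) by (simp add: field_simps)
  have cd: "((\<lambda>x. cos (\<theta> x)) has_real_derivative - sin (\<theta> x) * r) (at x)"
    unfolding r_def by (auto intro!: derivative_eq_intros d)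
  have "(profile_slope A \<mu> \<theta> has_real_derivative
     m * (cos (\<theta> x) * (- (\<mu> * sin (\<theta> x) * cos (\<theta> x)) / A) + - sin (\<theta> x) * r * r)) (at x)"
    unfolding profile_slope_def m_def[symmetric]
    by (rule DERIV_cmult[OF DERIV_mult'[OF cd sd], folded r_def])
  moreover have "m * (cos (\<theta> x) * (- (\<mu> * sin (\<theta> x) * cos (\<theta> x)) / A) + - sin (\<theta> x) * r * r) =
    - (lam * profile \<mu> \<theta> x - b * profile \<mu> \<theta> x ^ 3) / A"
  proof -
    have "- sin (\<theta> x) * r * r = - (sin (\<theta> x) * Q \<mu> (\<theta> x)) / A"
      using r(2) by (simp add: mult.assoc)
    then have "m * (cos (\<theta> x) * (- (\<mu> * sin (\<theta> x) * cos (\<theta> x)) / A) + - sin (\<theta> x) * r * r) =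
      - (m * sin (\<theta> x)) * (\<mu> * (cos (\<theta> x))\<^sup>2 + Q \<mu> (\<theta> x)) / A"
      using A by (simp add: field_simps power2_eq_square)
    also have "\<mu> * (cos (\<theta> x))\<^sup>2 + Q \<mu> (\<theta> x) = lam - 2 * \<mu> * (sin (\<theta> x))\<^sup>2"
      by (simp add: Q_def cos_squared_eq algebra_simps)
    finally have "m * (cos (\<theta> x) * (- (\<mu> * sin (\<theta> x) * cos (\<theta> x)) / A) + - sin (\<theta> x) * r * r) =
      - (m * sin (\<theta> x)) * (lam - 2 * \<mu> * (sin (\<theta> x))\<^sup>2) / A" .
    also have "\<dots> = - (lam * (m * sin (\<theta> x)) - (2 * \<mu> * m) * sin (\<theta> x) ^ 3) / A"
      by (simp add: algebra_simps power2_eq_square power3_eq_cube)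
    also have "(2 * \<mu> * m) * sin (\<theta> x) ^ 3 = b * (m * sin (\<theta> x)) ^ 3"
      using m by (simp add: power_mult_distrib mult.assoc[symmetric])
    finally show ?thesis by (simp add: profile_def m_def)
  qed
  ultimately show "(profile_slope A \<mu> \<theta> has_real_derivative - (lam * profile \<mu> \<theta> x - b * profile \<mu> \<theta> x ^ 3) / A) (at x)"
    by simp
qed

lemma profile_classical_solution:
  assumes "A > 0" "0 \<le> \<mu>" "\<mu> < lam / 2" "is_phase A \<mu> \<theta>"
  shows "classical_solution A b lam (profile \<mu> \<theta>) (profile_slope A \<mu> \<theta>)"
  using profile_solution[OF assms] by (auto simp: classical_solution_def intro: has_field_derivative_at_within)

text \<open>The amplitude is nonzero, and \<theta> increases strictly from 0; to the right of 0 it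
  meets exactly the nonnegative multiples of \<open>pi\<close>, each once.\<close>

lemma profile_zero_iff:
  assumes A: "A > 0" and \<mu>: "0 < \<mu>" "\<mu> < lam / 2" and \<theta>: "is_phase A \<mu> \<theta>" and x: "x \<ge> 0"
  shows "profile \<mu> \<theta> x = 0 \<longleftrightarrow> (\<exists>k::nat. x = real k * (sqrt A * half_period \<mu>))"
proof
  have \<mu>0: "0 \<le> \<mu>" using \<mu> by simp
  assume "profile \<mu> \<theta> x = 0"
  then have "sin (\<theta> x) = 0" using \<mu> b_pos by (simp add: profile_def)
  then obtain i :: int where i: "\<theta> x = of_int i * pi" using sin_zero_iff_int2 by blast
  have "\<theta> 0 = 0" using \<theta> by (simp add: is_phase_def)
  then have "\<theta> x \<ge> 0"
    using phase_strict_mono[OF A \<mu>0 \<mu>(2) \<theta>, of 0 x] x by (cases "x = 0") auto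
  then have "i \<ge> 0" using i pi_gt_zero by (simp add: zero_le_mult_iff)
  then have "\<theta> x = real (nat i) * pi" using i by simp
  then have "\<theta> x = \<theta> (real (nat i) * (sqrt A * half_period \<mu>))" using \<theta> by (simp add: is_phase_def)
  then show "\<exists>k::nat. x = real k * (sqrt A * half_period \<mu>)"
    using phase_strict_mono[OF A \<mu>0 \<mu>(2) \<theta>] by (metis linorder_neqE_linordered_idom less_irrefl)
next
  assume "\<exists>k::nat. x = real k * (sqrt A * half_period \<mu>)"
  then show "profile \<mu> \<theta> x = 0"
    using \<theta> by (auto simp: is_phase_def profile_def)
qed

text \<open>Both end points are zeros: \<open>j\<close> arches are bounded by \<open>j + 1\<close>
  of them.\<close>

lemma card_profile_zeros:
  assumes A: "A > 0" and \<mu>: "0 < \<mu>" "\<mu> < lam / 2" and \<theta>: "is_phase A \<mu> \<theta>"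
    and j: "real j * (sqrt A * half_period \<mu>) = pi"
  shows "card {x \<in> {0..pi}. profile \<mu> \<theta> x = 0} = j + 1"
proof -
  define L where "L = sqrt A * half_period \<mu>"
  have L: "L > 0" using A half_period_pos[of \<mu>] \<mu> by (simp add: L_def)
  have "{x \<in> {0..pi}. profile \<mu> \<theta> x = 0} = (\<lambda>k. real k * L) ` {0..j}"
  proof (intro set_eqI iffI)
    fix x assume "x \<in> {x \<in> {0..pi}. profile \<mu> \<theta> x = 0}"
    then obtain k :: nat where k: "x = real k * L" "x \<le> pi"
      using profile_zero_iff[OF A \<mu> \<theta>] by (auto simp: L_def)
    then have "real k * L \<le> real j * L" using j by (simp add: L_def)
    then have "k \<le> j" using L by simp
    then show "x \<in> (\<lambda>k. real k * L) ` {0..j}" using k by auto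
  next
    fix x assume "x \<in> (\<lambda>k. real k * L) ` {0..j}"
    then obtain k where k: "x = real k * L" "k \<in> {0..j}" by (rule imageE)
    then have "x \<le> real j * L" "x \<ge> 0" using L by auto
    then show "x \<in> {x \<in> {0..pi}. profile \<mu> \<theta> x = 0}"
      using profile_zero_iff[OF A \<mu> \<theta>] k j by (auto simp: L_def)
  qed
  moreover have "inj_on (\<lambda>k. real k * L) {0..j}" using L by (auto simp: inj_on_def)
  ultimately show ?thesis by (simp add: card_image)
qed

text \<open>The substitution \<open>t = \<theta> x\<close> is run backwards:
  \<open>m / sqrt A * Y (\<theta> x)\<close> is an antiderivative of the squared slope, one square
  root of \<open>Q\<close> stemming from \<open>Y\<close> and the other from the derivative of
  \<theta>. The second conclusion is the arch-length condition solved for \<open>A\<close>.\<close>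

lemma integral_profile_slope:
  assumes A: "A > 0" and \<mu>: "0 < \<mu>" "\<mu> < lam / 2" and \<theta>: "is_phase A \<mu> \<theta>"
    and j: "real j * (sqrt A * half_period \<mu>) = pi"
  shows "integral {0..pi} (\<lambda>x. (profile_slope A \<mu> \<theta> x)\<^sup>2) = dirichlet j \<mu>"
    and "A = diffusivity j \<mu>"
proof -
  have I: "half_period \<mu> > 0" using half_period_pos \<mu> by simp
  have jpos: "real j > 0" using j pi_gt_zero by (cases "j = 0") auto
  have sA: "sqrt A = pi / (real j * half_period \<mu>)" using j jpos I by (simp add: field_simps)
  then show "A = diffusivity j \<mu>" using A by (metis diffusivity_def real_sqrt_pow2 less_imp_le)
  obtain Y where Y: "Y 0 = 0" "\<And>t. (Y has_real_derivative (cos t)\<^sup>2 * sqrt (Q \<mu> t)) (at t)"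
    using exists_antiderivative[OF continuous_action_integrand] by metis
  have Y\<pi>: "Y (real k * pi) = real k * half_action \<mu>" for k
    unfolding half_action_def by (rule antiderivative_periodic[OF Y(2,1)]) (simp add: Q_def)
  define m where "m = 2 * \<mu> / b"
  have m: "m > 0" using \<mu> b_pos by (simp add: m_def)
  have d: "(\<theta> has_real_derivative sqrt (Q \<mu> (\<theta> x) / A)) (at x)" for x using \<theta> by (simp add: is_phase_def)
  have "((\<lambda>x. m / sqrt A * Y (\<theta> x)) has_real_derivative (profile_slope A \<mu> \<theta> x)\<^sup>2) (at x)" for x
  proof -
    have Qp: "Q \<mu> (\<theta> x) > 0" using Q_pos \<mu> by simp
    have "((\<lambda>x. m / sqrt A * Y (\<theta> x)) has_real_derivative
        m / sqrt A * ((cos (\<theta> x))\<^sup>2 * sqrt (Q \<mu> (\<theta> x)) * sqrt (Q \<mu> (\<theta> x) / A))) (at x)"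
      by (intro DERIV_cmult DERIV_chain2[OF Y(2) d])
    moreover have "m / sqrt A * ((cos (\<theta> x))\<^sup>2 * sqrt (Q \<mu> (\<theta> x)) * sqrt (Q \<mu> (\<theta> x) / A)) = (profile_slope A \<mu> \<theta> x)\<^sup>2"
    proof -
      have "(profile_slope A \<mu> \<theta> x)\<^sup>2 = m * ((cos (\<theta> x))\<^sup>2 * (Q \<mu> (\<theta> x) / A))"
        using Qp A m by (simp add: profile_slope_def m_def[symmetric] power_mult_distrib)
      moreover have "sqrt (Q \<mu> (\<theta> x)) * sqrt (Q \<mu> (\<theta> x) / A) / sqrt A = Q \<mu> (\<theta> x) / A"
        using Qp A by (simp add: real_sqrt_divide)
      moreover have "m / sqrt A * (c * s * t) = m * (c * (s * t / sqrt A))" for c s t :: real by simp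
      ultimately show ?thesis by (simp only:)
    qed
    ultimately show ?thesis by simp
  qed
  then have "((\<lambda>x. (profile_slope A \<mu> \<theta> x)\<^sup>2) has_integral m / sqrt A * Y (\<theta> pi) - m / sqrt A * Y (\<theta> 0)) {0..pi}"
    by (intro fundamental_theorem_of_calculus)
       (auto simp: has_real_derivative_iff_has_vector_derivative[symmetric] intro: has_field_derivative_at_within)
  moreover have "\<theta> pi = real j * pi" "\<theta> 0 = 0" using \<theta> j unfolding is_phase_def by metis+
  ultimately have "integral {0..pi} (\<lambda>x. (profile_slope A \<mu> \<theta> x)\<^sup>2) = m / sqrt A * (real j * half_action \<mu>)"
    by (simp add: Y\<pi> Y(1) integral_unique)
  also have "\<dots> = dirichlet j \<mu>"
    using jpos I by (simp add: sA dirichlet_def m_def power2_eq_square ac_simps)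
  finally show "integral {0..pi} (\<lambda>x. (profile_slope A \<mu> \<theta> x)\<^sup>2) = dirichlet j \<mu>" .
qed

end

section \<open>Classification of the classical solutions\<close>

lemma DERIV_within_nonneg_imp_le:
  fixes f :: "real \<Rightarrow> real"
  assumes d: "\<And>x. x \<in> {p..q} \<Longrightarrow> (f has_real_derivative f' x) (at x within {p..q})"
    and nn: "\<And>x. x \<in> {p..q} \<Longrightarrow> f' x \<ge> 0" and "p \<le> s" "s \<le> t" "t \<le> q"
  shows "f s \<le> f t"
proof (rule DERIV_nonneg_imp_increasing_open[OF \<open>s \<le> t\<close>])
  fix x assume x: "s < x" "x < t"
  then have "(f has_real_derivative f' x) (at x)"
    using d[of x] assms(3-5) at_within_Icc_at[of p x q] by auto
  then show "\<exists>y. (f has_real_derivative y) (at x) \<and> 0 \<le> y" using nn[of x] x assms(3-5) by auto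
next
  show "continuous_on {s..t} f"
    by (rule continuous_on_subset[OF DERIV_continuous_on[OF d]]) (use assms(3-5) in auto)
qed

text \<open>One integrating factor per direction: \<open>w\<close> times
  \<open>exp (- (L * x))\<close> is nonincreasing, \<open>w\<close> times \<open>exp (L * x)\<close>
  nondecreasing. So a zero spreads to the right and to the left, which is why the absolute value of
  \<open>w'\<close> is bounded.\<close>

lemma gronwall_zero:
  fixes w :: "real \<Rightarrow> real"
  assumes d: "\<And>x. x \<in> {p..q} \<Longrightarrow> (w has_real_derivative w' x) (at x within {p..q})"
    and bound: "\<And>x. x \<in> {p..q} \<Longrightarrow> \<bar>w' x\<bar> \<le> L * w x"
    and nn: "\<And>x. w x \<ge> 0" and x0: "x0 \<in> {p..q}" "w x0 = 0" and x: "x \<in> {p..q}"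
  shows "w x = 0"
proof (cases "x0 \<le> x")
  case True
  have "- (w x0 * exp (- (L * x0))) \<le> - (w x * exp (- (L * x)))"
  proof (rule DERIV_within_nonneg_imp_le[where p=p and q=q and f="\<lambda>x. - (w x * exp (- (L * x)))"
      and f'="\<lambda>x. (L * w x - w' x) * exp (- (L * x))"])
    fix y assume y: "y \<in> {p..q}"
    show "((\<lambda>x. - (w x * exp (- (L * x)))) has_real_derivative (L * w y - w' y) * exp (- (L * y))) (at y within {p..q})"
      by (auto intro!: derivative_eq_intros d[OF y] simp: algebra_simps)
    show "0 \<le> (L * w y - w' y) * exp (- (L * y))" using bound[OF y] by auto
  qed (use True x0 x in auto)
  then have "w x * exp (- (L * x)) \<le> 0" using x0 by simp
  then have "w x \<le> 0" by (simp add: mult_le_0_iff)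
  then show ?thesis using nn[of x] by simp
next
  case False
  have "w x * exp (L * x) \<le> w x0 * exp (L * x0)"
  proof (rule DERIV_within_nonneg_imp_le[where p=p and q=q and f="\<lambda>x. w x * exp (L * x)"
      and f'="\<lambda>x. (L * w x + w' x) * exp (L * x)"])
    fix y assume y: "y \<in> {p..q}"
    show "((\<lambda>x. w x * exp (L * x)) has_real_derivative (L * w y + w' y) * exp (L * y)) (at y within {p..q})"
      by (auto intro!: derivative_eq_intros d[OF y] simp: algebra_simps)
    show "0 \<le> (L * w y + w' y) * exp (L * y)" using bound[OF y] by auto
  qed (use False x0 x in auto)
  then have "w x * exp (L * x) \<le> 0" using x0 by simp
  then have "w x \<le> 0" by (simp add: mult_le_0_iff)
  then show ?thesis using nn[of x] by simp
qed

text \<open>Gronwall's inequality is applied to the squared distance in the phase plane; the cubic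
  is handled by a coefficient that is bounded because both solutions are continuous on a compact
  interval. The common point may be an interior turning point.\<close>

lemma classical_solution_unique:
  assumes 1: "classical_solution A b lam u v" and 2: "classical_solution A b lam u' v'"
    and x0: "x0 \<in> {0..pi}" "u x0 = u' x0" "v x0 = v' x0" and x: "x \<in> {0..pi}"
  shows "u x = u' x \<and> v x = v' x"
proof -
  have d1: "\<And>x. x \<in> {0..pi} \<Longrightarrow> (u has_real_derivative v x) (at x within {0..pi})"
    "\<And>x. x \<in> {0..pi} \<Longrightarrow> (v has_real_derivative - (lam * u x - b * u x ^ 3) / A) (at x within {0..pi})"
    using 1 by (auto simp: classical_solution_def)
  have d2: "\<And>x. x \<in> {0..pi} \<Longrightarrow> (u' has_real_derivative v' x) (at x within {0..pi})"
    "\<And>x. x \<in> {0..pi} \<Longrightarrow> (v' has_real_derivative - (lam * u' x - b * u' x ^ 3) / A) (at x within {0..pi})"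
    using 2 by (auto simp: classical_solution_def)
  define p where "p x = u x - u' x" for x
  define q where "q x = v x - v' x" for x
  \<comment> \<open>Difference quotient of the cubic: \<open>u x ^ 3 - u' x ^ 3\<close> is divisible
    by \<open>u x - u' x\<close>, so the difference of the solutions solves a linear system.\<close>
  define c where "c x = (lam - b * ((u x)\<^sup>2 + u x * u' x + (u' x)\<^sup>2)) / A" for x
  have dp: "(p has_real_derivative q x) (at x within {0..pi})" if "x \<in> {0..pi}" for x
    unfolding p_def q_def by (intro DERIV_diff d1 d2 that)
  have dq: "(q has_real_derivative - c x * p x) (at x within {0..pi})" if "x \<in> {0..pi}" for x
  proof -
    have "- (lam * u x - b * u x ^ 3) / A - - (lam * u' x - b * u' x ^ 3) / A = - c x * p x"
      by (simp add: c_def p_def diff_divide_distrib[symmetric] minus_divide_left algebra_simps power2_eq_square power3_eq_cube)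
    then show ?thesis unfolding q_def using DERIV_diff[OF d1(2)[OF that] d2(2)[OF that]] by simp
  qed
  have "continuous_on {0..pi} u" "continuous_on {0..pi} u'"
    by (rule DERIV_continuous_on[OF d1(1)], assumption) (rule DERIV_continuous_on[OF d2(1)])
  then have "continuous_on {0..pi} c" unfolding c_def divide_inverse by (intro continuous_intros)
  then have "compact (c ` {0..pi})" by (intro compact_continuous_image) auto
  then obtain C where C: "\<And>x. x \<in> {0..pi} \<Longrightarrow> \<bar>c x\<bar> \<le> C"
    using compact_imp_bounded[of "c ` {0..pi}"] by (auto simp: bounded_iff simp del: atLeastAtMost_iff)
  have "(p x)\<^sup>2 + (q x)\<^sup>2 = 0"
  proof (rule gronwall_zero[where p=0 and q=pi and L="1 + C" and w="\<lambda>x. (p x)\<^sup>2 + (q x)\<^sup>2"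
      and w'="\<lambda>x. 2 * p x * q x + 2 * q x * (- c x * p x)"])
    fix x assume x: "x \<in> {0..pi}"
    show "((\<lambda>x. (p x)\<^sup>2 + (q x)\<^sup>2) has_real_derivative 2 * p x * q x + 2 * q x * (- c x * p x)) (at x within {0..pi})"
      by (auto intro!: derivative_eq_intros dp[OF x] dq[OF x])
    have "2 * p x * q x + 2 * q x * (- c x * p x) = (1 - c x) * (2 * p x * q x)"
      by (simp add: algebra_simps)
    then have "\<bar>2 * p x * q x + 2 * q x * (- c x * p x)\<bar> = \<bar>1 - c x\<bar> * (2 * \<bar>p x\<bar> * \<bar>q x\<bar>)"
      by (simp only: abs_mult abs_numeral)
    also have "\<dots> \<le> (1 + C) * ((p x)\<^sup>2 + (q x)\<^sup>2)"
    proof (rule mult_mono)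
      show "\<bar>1 - c x\<bar> \<le> 1 + C" "0 \<le> 1 + C" using C[OF x] by auto
      have "0 \<le> (\<bar>p x\<bar> - \<bar>q x\<bar>)\<^sup>2" by simp
      then show "2 * \<bar>p x\<bar> * \<bar>q x\<bar> \<le> (p x)\<^sup>2 + (q x)\<^sup>2" by (simp add: power2_diff)
    qed auto
    finally show "\<bar>2 * p x * q x + 2 * q x * (- c x * p x)\<bar> \<le> (1 + C) * ((p x)\<^sup>2 + (q x)\<^sup>2)" .
  qed (use x0 x in \<open>auto simp: p_def q_def\<close>)
  then show ?thesis by (simp add: p_def q_def sum_power2_eq_zero_iff)
qed

lemma classical_solution_minus:
  assumes "classical_solution A b lam u v" shows "classical_solution A b lam (\<lambda>x. - u x) (\<lambda>x. - v x)"
  using assms by (auto simp: classical_solution_def diff_divide_distrib intro!: derivative_eq_intros)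

lemma classical_solution_const:
  assumes "lam * k - b * k ^ 3 = 0" shows "classical_solution A b lam (\<lambda>x. k) (\<lambda>x. 0)"
  using assms by (auto simp: classical_solution_def)

lemma classical_solution_energy:
  assumes sol: "classical_solution A b lam u v" and A: "A > 0" and x: "x \<in> {0..pi}" "y \<in> {0..pi}"
  shows "A * (v x)\<^sup>2 / 2 + lam * (u x)\<^sup>2 / 2 - b * u x ^ 4 / 4 = A * (v y)\<^sup>2 / 2 + lam * (u y)\<^sup>2 / 2 - b * u y ^ 4 / 4"
proof -
  define e where "e x = A * (v x)\<^sup>2 / 2 + lam * (u x)\<^sup>2 / 2 - b * u x ^ 4 / 4" for x
  have "\<exists>c. \<forall>x\<in>{0..pi}. e x = c"
  proof (rule has_field_derivative_zero_constant)
    fix x assume "x \<in> {0..pi}"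
    then have d: "(u has_real_derivative v x) (at x within {0..pi})"
      "(v has_real_derivative - (lam * u x - b * u x ^ 3) / A) (at x within {0..pi})"
      using sol by (auto simp: classical_solution_def)
    define w where "w = - (lam * u x - b * u x ^ 3) / A"
    have "A * w = - (lam * u x - b * u x ^ 3)" using A by (simp add: w_def)
    then have "A * (v x * w) = - (lam * u x - b * u x ^ 3) * v x" by (metis mult.commute mult.left_commute)
    then show "(e has_real_derivative 0) (at x within {0..pi})"
      unfolding e_def by (auto intro!: derivative_eq_intros d(1) d(2)[folded w_def] simp: algebra_simps)
  qed simp
  then show ?thesis using x unfolding e_def by metis
qed

context cubic_nonlinearity
begin

text \<open>The energy gives \<mu>, and the profile with this parameter has the same value and, up
  to the sign \<open>s\<close>, the same slope at 0; uniqueness does the rest. The representation is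
  claimed for every phase so that phases fixed elsewhere can be inserted.\<close>

lemma classical_solution_cases:
  assumes sol: "classical_solution A b lam u v" and A: "A > 0" and ends: "u 0 = 0" "u pi = 0"
    and nz: "x1 \<in> {0..pi}" "u x1 \<noteq> 0"
  obtains \<mu> j s where "0 < \<mu>" "\<mu> < lam / 2" "j \<ge> 1" "real j * (sqrt A * half_period \<mu>) = pi" "s = 1 \<or> s = -1"
    "\<And>\<theta> x. is_phase A \<mu> \<theta> \<Longrightarrow> x \<in> {0..pi} \<Longrightarrow> u x = s * profile \<mu> \<theta> x \<and> v x = s * profile_slope A \<mu> \<theta> x"
proof -
  define E where "E = A * (v 0)\<^sup>2 / 2"
  have v0: "v 0 \<noteq> 0"
  proof
    assume "v 0 = 0"
    then have "u x1 = 0"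
      using classical_solution_unique[OF sol classical_solution_const[of lam 0 b A], of 0 x1] ends nz by simp
    then show False using nz by simp
  qed
  then have E: "E > 0" using A by (simp add: E_def)
  have d: "\<And>x. x \<in> {0..pi} \<Longrightarrow> (u has_real_derivative v x) (at x within {0..pi})"
    using sol by (auto simp: classical_solution_def)
  have d': "(u has_real_derivative v x) (at x)" if "0 < x" "x < pi" for x
    using d[of x] at_within_Icc_at[of 0 x pi] that by auto
  \<comment> \<open>At a critical point the energy depends on the value \<open>k\<close> alone,
    which turns the discriminant \<open>lam\<^sup>2 - 4 * b * E\<close> into a square.\<close>
  obtain x0 where x0: "0 < x0" "x0 < pi" "(u has_real_derivative 0) (at x0)"
    using Rolle[OF pi_gt_zero, of u] ends DERIV_continuous_on[OF d] d' real_differentiable_def by metis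
  have vx0: "v x0 = 0" using DERIV_unique[OF d' x0(3)] x0 by simp
  define k where "k = u x0"
  have Ek: "E = lam * k\<^sup>2 / 2 - b * k ^ 4 / 4"
    using classical_solution_energy[OF sol A, of 0 x0] x0 ends vx0 by (simp add: E_def k_def)
  have gap: "lam\<^sup>2 - 4 * b * E = (lam - b * k\<^sup>2)\<^sup>2"
    by (simp add: Ek power2_eq_square power4_eq_xxxx algebra_simps)
  \<comment> \<open>At the critical energy the solution would coincide with the constant solution \<open>k\<close>.\<close>
  have "lam - b * k\<^sup>2 \<noteq> 0"
  proof
    assume eq: "lam - b * k\<^sup>2 = 0"
    have "lam * k - b * k ^ 3 = k * (lam - b * k\<^sup>2)" by (simp add: algebra_simps power2_eq_square power3_eq_cube)
    then have c: "lam * k - b * k ^ 3 = 0" using eq by simp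
    have x0m: "x0 \<in> {0..pi}" using x0 by simp
    have "u 0 = k"
      using classical_solution_unique[OF sol classical_solution_const[OF c] x0m k_def[symmetric] vx0, of 0] by simp
    then show False using eq ends lam_pos by simp
  qed
  then have Esmall: "lam\<^sup>2 - 4 * b * E > 0" unfolding gap by simp
  \<comment> \<open>The smaller root of \<open>\<mu> * (lam - \<mu>) = b * E\<close>; the larger one
    exceeds \<open>lam / 2\<close>, where \<open>Q\<close> no longer stays positive.\<close>
  define \<mu> where "\<mu> = (lam - sqrt (lam\<^sup>2 - 4 * b * E)) / 2"
  have sq: "sqrt (lam\<^sup>2 - 4 * b * E) > 0" "sqrt (lam\<^sup>2 - 4 * b * E) < lam"
    using Esmall E b_pos lam_pos by (auto intro!: real_less_lsqrt)
  have \<mu>: "0 < \<mu>" "\<mu> < lam / 2" using sq by (auto simp: \<mu>_def)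
  have "(sqrt (lam\<^sup>2 - 4 * b * E))\<^sup>2 = lam\<^sup>2 - 4 * b * E" using Esmall by simp
  moreover have "\<mu> * (lam - \<mu>) = (lam\<^sup>2 - (sqrt (lam\<^sup>2 - 4 * b * E))\<^sup>2) / 4"
    unfolding \<mu>_def by (simp only: power2_eq_square) (simp add: field_simps)
  ultimately have \<mu>E: "\<mu> * (lam - \<mu>) = b * E" by simp
  \<comment> \<open>A profile always leaves 0 upwards; the sign of \<open>v 0\<close> selects it or
    its negative.\<close>
  define s where "s = (if (v 0 > 0) then 1 else -1 :: real)"
  have s: "s = 1 \<or> s = -1" by (simp add: s_def)
  have rep: "u x = s * profile \<mu> \<theta> x \<and> v x = s * profile_slope A \<mu> \<theta> x"
    if \<theta>: "is_phase A \<mu> \<theta>" and x: "x \<in> {0..pi}" for \<theta> x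
  proof -
    have \<theta>0: "\<theta> 0 = 0" using \<theta> by (simp add: is_phase_def)
    have "(profile_slope A \<mu> \<theta> 0)\<^sup>2 = 2 * (\<mu> * (lam - \<mu>)) / (b * A)"
      using \<mu> A b_pos by (simp add: profile_slope_def \<theta>0 Q_def power_mult_distrib)
    also have "\<dots> = (v 0)\<^sup>2" using A b_pos by (simp add: \<mu>E E_def)
    finally have "\<bar>profile_slope A \<mu> \<theta> 0\<bar> = \<bar>v 0\<bar>" by (simp add: power2_eq_iff abs_eq_iff)
    moreover have "profile_slope A \<mu> \<theta> 0 \<ge> 0"
      using \<mu> A b_pos by (simp add: profile_slope_def \<theta>0 Q_def)
    ultimately have slope: "v 0 = s * profile_slope A \<mu> \<theta> 0" by (auto simp: s_def)
    have \<mu>0: "0 \<le> \<mu>" using \<mu> by simp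
    have psol: "classical_solution A b lam (\<lambda>x. s * profile \<mu> \<theta> x) (\<lambda>x. s * profile_slope A \<mu> \<theta> x)"
      using s profile_classical_solution[OF A \<mu>0 \<mu>(2) \<theta>] classical_solution_minus[OF profile_classical_solution[OF A \<mu>0 \<mu>(2) \<theta>]]
      by auto
    show ?thesis
      using classical_solution_unique[OF sol psol, of 0 x] slope x ends by (simp add: profile_def \<theta>0)
  qed
  obtain \<theta> where \<theta>: "is_phase A \<mu> \<theta>" using phase_exists[OF A, of \<mu>] \<mu> by auto
  have "profile \<mu> \<theta> pi = 0" using rep[OF \<theta>, of pi] ends s by auto
  then obtain j :: nat where j: "pi = real j * (sqrt A * half_period \<mu>)"
    using profile_zero_iff[OF A \<mu> \<theta>, of pi] by auto
  have "j \<ge> 1" using j pi_gt_zero by (cases j) auto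
  then show ?thesis using that[OF \<mu> _ j[symmetric] s rep] by blast
qed

end

section \<open>Dependence on the amplitude\<close>

context cubic_nonlinearity
begin

lemma half_period_strict_mono:
  assumes "0 \<le> \<mu>" "\<mu> < \<nu>" "\<nu> < lam / 2"
  shows "half_period \<mu> < half_period \<nu>"
  unfolding half_period_def
proof (rule integral_less_real)
  fix t assume "t \<in> {-(pi/2)<..<pi/2}"
  have "\<mu> * (1 + (sin t)\<^sup>2) < \<nu> * (1 + (sin t)\<^sup>2)"
    using assms by (intro mult_strict_right_mono) (auto simp: add_pos_nonneg)
  then have "Q \<nu> t < Q \<mu> t" by (simp add: Q_def)
  then show "1 / sqrt (Q \<mu> t) < 1 / sqrt (Q \<nu> t)"
    using Q_pos[of \<nu> t] assms by (intro divide_strict_left_mono) auto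
next
  have "0 \<in> {-(pi/2)<..<pi/2}" using pi_half_gt_zero by auto
  then show "{-(pi/2)<..<pi/2} \<noteq> {}" by blast
qed (use assms continuous_inverse_sqrt_Q in auto)

lemma half_period_0: "half_period 0 = pi / sqrt lam"
  by (simp add: half_period_def Q_def)

lemma continuous_half_period: "continuous_on {0..<lam/2} half_period"
proof -
  have "continuous_on ({0..<lam/2} \<times> cbox (-(pi/2)) (pi/2)) (\<lambda>(\<mu>, t). 1 / sqrt (Q \<mu> t))"
    unfolding case_prod_beta
  proof (intro continuous_intros)
    show "continuous_on ({0..<lam/2} \<times> cbox (-(pi/2)) (pi/2)) (\<lambda>x. Q (fst x) (snd x))"
      unfolding Q_def by (intro continuous_intros)
    show "\<forall>x\<in>{0..<lam/2} \<times> cbox (-(pi/2)) (pi/2). sqrt (Q (fst x) (snd x)) \<noteq> 0"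
      using Q_pos by (auto simp: less_imp_neq[symmetric])
  qed
  then show ?thesis
    using integral_continuous_on_param[of "{0..<lam/2}" "-(pi/2)" "pi/2" "\<lambda>\<mu> t. 1 / sqrt (Q \<mu> t)"]
    unfolding half_period_def by simp
qed

text \<open>Real \<open>sqrt\<close> is the odd continuous extension to the whole line, so the
  integrand is jointly continuous for all \<mu>, unlike its reciprocal counterpart in
  \<open>half_period\<close>.\<close>

lemma continuous_half_action: "continuous_on T half_action"
proof -
  have "continuous_on (T \<times> cbox (-(pi/2)) (pi/2)) (\<lambda>(\<mu>, t). (cos t)\<^sup>2 * sqrt (Q \<mu> t))"
    unfolding case_prod_beta Q_def by (intro continuous_intros)
  then show ?thesis
    using integral_continuous_on_param[of T "-(pi/2)" "pi/2" "\<lambda>\<mu> t. (cos t)\<^sup>2 * sqrt (Q \<mu> t)"]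
    unfolding half_action_def by simp
qed

lemma half_action_nonneg:
  assumes "0 \<le> \<mu>" "\<mu> < lam / 2" shows "half_action \<mu> \<ge> 0"
  unfolding half_action_def
  using less_imp_le[OF Q_pos[OF assms]]
  by (intro integral_nonneg integrable_continuous_real continuous_action_integrand) simp

text \<open>The substitution \<open>y = sqrt \<mu> * sin t\<close> turns the action into an integral whose integrand is
  monotone in \<open>\<mu>\<close>, which \<open>\<mu> * (cos t)\<^sup>2 * sqrt (Q \<mu> t)\<close> is not.\<close>

lemma half_action_substitution:
  assumes \<mu>: "0 \<le> \<mu>" "\<mu> < lam / 2"
  shows "\<mu> * half_action \<mu> = integral {- sqrt \<mu>..sqrt \<mu>} (\<lambda>y. sqrt ((\<mu> - y\<^sup>2) * (lam - \<mu> - y\<^sup>2)))"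
proof -
  define r where "r = sqrt \<mu>"
  have r: "r \<ge> 0" "r\<^sup>2 = \<mu>" using \<mu> by (auto simp: r_def)
  have sub: "((\<lambda>t. (r * cos t) *\<^sub>R sqrt ((\<mu> - (r * sin t)\<^sup>2) * (lam - \<mu> - (r * sin t)\<^sup>2))) has_integral
      integral {r * sin (-(pi/2))..r * sin (pi/2)} (\<lambda>y. sqrt ((\<mu> - y\<^sup>2) * (lam - \<mu> - y\<^sup>2)))) {-(pi/2)..pi/2}"
  proof (rule has_integral_substitution[where c="-r" and d=r])
    show "(\<lambda>t. r * sin t) ` {- (pi / 2)..pi / 2} \<subseteq> {- r..r}"
    proof
      fix y assume "y \<in> (\<lambda>t. r * sin t) ` {- (pi / 2)..pi / 2}"
      then obtain t where "y = r * sin t" by auto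
      then show "y \<in> {-r..r}"
        using mult_left_mono[OF sin_le_one r(1), of t] mult_left_mono[OF sin_ge_minus_one r(1), of t] by simp
    qed
    show "continuous_on {- r..r} (\<lambda>y. sqrt ((\<mu> - y\<^sup>2) * (lam - \<mu> - y\<^sup>2)))" by (intro continuous_intros)
    show "((\<lambda>t. r * sin t) has_real_derivative r * cos x) (at x within {- (pi / 2)..pi / 2})" for x
      by (auto intro!: derivative_eq_intros)
  qed (use r in auto)
  have eq: "(r * cos t) *\<^sub>R sqrt ((\<mu> - (r * sin t)\<^sup>2) * (lam - \<mu> - (r * sin t)\<^sup>2)) = \<mu> * ((cos t)\<^sup>2 * sqrt (Q \<mu> t))"
    if "t \<in> {-(pi/2)..pi/2}" for t
  proof -
    have c: "cos t \<ge> 0" using that by (intro cos_ge_zero) auto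
    have "\<mu> - (r * sin t)\<^sup>2 = (r * cos t)\<^sup>2"
      by (simp add: power_mult_distrib r cos_squared_eq algebra_simps)
    moreover have "lam - \<mu> - (r * sin t)\<^sup>2 = Q \<mu> t"
      by (simp add: power_mult_distrib r Q_def algebra_simps)
    ultimately have "sqrt ((\<mu> - (r * sin t)\<^sup>2) * (lam - \<mu> - (r * sin t)\<^sup>2)) = r * cos t * sqrt (Q \<mu> t)"
      using r c by (simp add: real_sqrt_mult)
    then show ?thesis using r by (simp add: power2_eq_square)
  qed
  have "((\<lambda>t. \<mu> * ((cos t)\<^sup>2 * sqrt (Q \<mu> t))) has_integral
      integral {-r..r} (\<lambda>y. sqrt ((\<mu> - y\<^sup>2) * (lam - \<mu> - y\<^sup>2)))) {-(pi/2)..pi/2}"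
    using has_integral_eq[OF eq sub] by simp
  from integral_unique[OF this] show ?thesis
    by (simp only: half_action_def r_def integral_mult_right)
qed

lemma action_mono:
  assumes "0 \<le> \<mu>" "\<mu> < \<nu>" "\<nu> < lam / 2"
  shows "\<mu> * half_action \<mu> \<le> \<nu> * half_action \<nu>"
proof -
  define P where "P \<mu> y = sqrt ((\<mu> - y\<^sup>2) * (lam - \<mu> - y\<^sup>2))" for \<mu> y :: real
  have cP: "continuous_on T (P \<mu>)" for T \<mu> unfolding P_def by (intro continuous_intros)
  have "integral {- sqrt \<mu>..sqrt \<mu>} (P \<mu>) \<le> integral {- sqrt \<mu>..sqrt \<mu>} (P \<nu>)"
  proof (rule integral_le)
    fix y assume "y \<in> {- sqrt \<mu>..sqrt \<mu>}"
    \<comment> \<open>The radicand expands to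
      \<open>\<mu> * (lam - \<mu>) - lam * y\<^sup>2 + y ^ 4\<close>, so this product is the
      difference of the two radicands.\<close>
    have "(\<nu> - \<mu>) * (lam - \<nu> - \<mu>) \<ge> 0" using assms by simp
    then show "P \<mu> y \<le> P \<nu> y" by (simp add: P_def algebra_simps)
  qed (intro integrable_continuous_real cP)+
  also have "\<dots> \<le> integral {- sqrt \<nu>..sqrt \<nu>} (P \<nu>)"
  proof (rule integral_subset_le)
    have "sqrt \<mu> \<le> sqrt \<nu>" using assms by simp
    then show "{- sqrt \<mu>..sqrt \<mu>} \<subseteq> {- sqrt \<nu>..sqrt \<nu>}" by (auto simp del: real_sqrt_le_iff)
    show "\<forall>y\<in>{- sqrt \<nu>..sqrt \<nu>}. 0 \<le> P \<nu> y"
    proof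
      fix y assume "y \<in> {- sqrt \<nu>..sqrt \<nu>}"
      then have "\<bar>y\<bar> \<le> sqrt \<nu>" by auto
      then have "\<bar>y\<bar>\<^sup>2 \<le> (sqrt \<nu>)\<^sup>2" by (intro power_mono) auto
      then have "y\<^sup>2 \<le> \<nu>" using assms by simp
      then show "0 \<le> P \<nu> y" using assms by (simp add: P_def)
    qed
  qed (intro integrable_continuous_real cP)+
  finally show ?thesis using assms half_action_substitution[of \<mu>] half_action_substitution[of \<nu>]
    unfolding P_def by simp
qed

text \<open>With \<open>e\<^sup>2 = lam - 2 * \<mu>\<close> and \<open>c = sqrt lam\<close>, on the
  right half of the window \<open>Q \<mu> t\<close> is at most
  \<open>(e + c * (pi/2 - t))\<^sup>2\<close>. The reciprocal of the square root of this bound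
  integrates to a logarithm that grows like \<open>- ln e / c\<close>.\<close>

lemma half_period_unbounded: "\<exists>\<mu>. 0 < \<mu> \<and> \<mu> < lam / 2 \<and> half_period \<mu> \<ge> M"
proof -
  define c where "c = sqrt lam"
  have c: "c > 0" "c\<^sup>2 = lam" using lam_pos by (auto simp: c_def)
  \<comment> \<open>The exponential bound makes \<open>- ln e\<close> at least
    \<open>c * M - ln (c * (pi/2))\<close>, just what the final estimate needs; the bound
    \<open>c / 2\<close> keeps \<open>e\<^sup>2 < lam\<close> and thus
    \<open>\<mu> > 0\<close>.\<close>
  define e where "e = min (c / 2) (exp (ln (c * (pi/2)) - c * M))"
  have e: "0 < e" "e \<le> c / 2" "e \<le> exp (ln (c * (pi/2)) - c * M)" using c by (auto simp: e_def)
  have e2: "e\<^sup>2 < lam"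
  proof -
    have "e\<^sup>2 < c\<^sup>2" using e c by (intro power_strict_mono) auto
    then show ?thesis using c by simp
  qed
  define \<mu> where "\<mu> = (lam - e\<^sup>2) / 2"
  have \<mu>: "0 < \<mu>" "\<mu> < lam / 2" "lam - 2 * \<mu> = e\<^sup>2" using e e2 by (auto simp: \<mu>_def field_simps)
  have cI: "continuous_on T (\<lambda>t. 1 / sqrt (Q \<mu> t))" for T using continuous_inverse_sqrt_Q \<mu> by simp
  have den: "e + c * (pi/2 - t) > 0" if "t \<le> pi/2" for t
    using e c that by (intro add_pos_nonneg) auto
  define G where "G t = - (1 / c) * ln (e + c * (pi/2 - t))" for t
  have "((\<lambda>t. 1 / (e + c * (pi/2 - t))) has_integral G (pi/2) - G 0) {0..pi/2}"
    unfolding G_def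
    by (intro fundamental_theorem_of_calculus)
       (use den c in \<open>auto simp: has_real_derivative_iff_has_vector_derivative[symmetric] intro!: derivative_eq_intros\<close>)
  then have "G (pi/2) - G 0 = integral {0..pi/2} (\<lambda>t. 1 / (e + c * (pi/2 - t)))" by (simp add: integral_unique)
  also have "\<dots> \<le> integral {0..pi/2} (\<lambda>t. 1 / sqrt (Q \<mu> t))"
  proof (rule integral_le)
    have "continuous_on {0..pi/2} (\<lambda>t. 1 / (e + c * (pi/2 - t)))"
      using den by (intro continuous_intros) (auto simp: less_imp_neq[symmetric])
    then show "(\<lambda>t. 1 / (e + c * (pi/2 - t))) integrable_on {0..pi/2}" by (rule integrable_continuous_real)
    show "(\<lambda>t. 1 / sqrt (Q \<mu> t)) integrable_on {0..pi/2}" by (intro integrable_continuous_real cI)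
    fix t assume t: "t \<in> {0..pi/2}"
    \<comment> \<open>\<open>cos t = sin (pi/2 - t)\<close> decays linearly at the right end, the
      source of the divergence.\<close>
    have ct: "0 \<le> cos t" "cos t \<le> pi/2 - t"
      using t sin_x_le_x[of "pi/2 - t"] by (auto simp: cos_sin_eq intro!: sin_ge_zero)
    have "Q \<mu> t = e\<^sup>2 + \<mu> * (cos t)\<^sup>2"
      unfolding \<mu>(3)[symmetric] Q_def by (simp add: sin_squared_eq algebra_simps)
    also have "\<dots> \<le> e\<^sup>2 + c\<^sup>2 * (pi/2 - t)\<^sup>2"
      using \<mu> c ct by (intro add_left_mono mult_mono power_mono) auto
    also have "\<dots> \<le> (e + c * (pi/2 - t))\<^sup>2"
      using e c t by (simp add: power2_sum power_mult_distrib)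
    finally have "sqrt (Q \<mu> t) \<le> e + c * (pi/2 - t)"
      using den[of t] t by (intro real_le_lsqrt) auto
    moreover have "sqrt (Q \<mu> t) > 0" using Q_pos[of \<mu> t] \<mu> by simp
    ultimately show "1 / (e + c * (pi/2 - t)) \<le> 1 / sqrt (Q \<mu> t)"
      using den[of t] t by (intro divide_left_mono mult_pos_pos) auto
  qed
  \<comment> \<open>The left half of the window is discarded, its integrand being positive.\<close>
  also have "\<dots> \<le> half_period \<mu>"
    unfolding half_period_def
    using Q_pos[of \<mu>] \<mu> by (intro integral_subset_le integrable_continuous_real cI) (auto intro: less_imp_le)
  finally have "G (pi/2) - G 0 \<le> half_period \<mu>" .
  moreover have "M \<le> G (pi/2) - G 0"
  proof -
    have "ln e \<le> ln (c * (pi/2)) - c * M" using e by (metis exp_gt_zero ln_exp ln_le_cancel_iff)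
    moreover have "ln (c * (pi/2)) \<le> ln (e + c * (pi/2))" using e c by (subst ln_le_cancel_iff) (auto intro: add_pos_pos)
    ultimately have "c * M \<le> ln (e + c * (pi/2)) - ln e" by simp
    then have "M \<le> (ln (e + c * (pi/2)) - ln e) / c" using c by (simp add: pos_le_divide_eq mult.commute)
    also have "\<dots> = G (pi/2) - G 0" by (simp add: G_def diff_divide_distrib)
    finally show ?thesis .
  qed
  ultimately show ?thesis using \<mu> by auto
qed

section \<open>Monotonicity in the amplitude and the consistency condition\<close>

lemma diffusivity_strict_antimono:
  assumes "0 \<le> \<mu>" "\<mu> < \<nu>" "\<nu> < lam / 2" "j \<ge> 1"
  shows "diffusivity j \<nu> < diffusivity j \<mu>"
  unfolding diffusivity_def
  using assms half_period_strict_mono[of \<mu> \<nu>] half_period_pos[of \<mu>] half_period_pos[of \<nu>]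
  by (intro power_strict_mono divide_strict_left_mono mult_strict_left_mono) auto

lemma dirichlet_mono:
  assumes "0 \<le> \<mu>" "\<mu> < \<nu>" "\<nu> < lam / 2"
  shows "dirichlet j \<mu> \<le> dirichlet j \<nu>"
proof -
  have "2 * \<mu> / b * half_action \<mu> \<le> 2 * \<nu> / b * half_action \<nu>"
    using action_mono[OF assms] b_pos by (simp add: divide_right_mono)
  moreover have "half_period \<mu> \<le> half_period \<nu>" "0 \<le> half_period \<mu>" "0 \<le> 2 * \<mu> / b * half_action \<mu>"
    using half_period_strict_mono[OF assms] half_period_pos[of \<mu>] half_action_nonneg[of \<mu>] assms b_pos by auto
  moreover from this have "(real j)\<^sup>2 / pi * half_period \<mu> \<le> (real j)\<^sup>2 / pi * half_period \<nu>"
    by (intro mult_left_mono) auto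
  ultimately show ?thesis
    unfolding dirichlet_def by (intro mult_mono[of "(real j)\<^sup>2 / pi * half_period \<mu>"]) auto
qed

lemma diffusivity_0: "diffusivity j 0 = lam / (real j)\<^sup>2"
  using lam_pos by (simp add: diffusivity_def half_period_0 power_divide power_mult_distrib)

lemma dirichlet_0: "dirichlet j 0 = 0"
  by (simp add: dirichlet_def)

text \<open>The bound \<open>0 < \<mu>\<close> shuts out amplitude zero, where the profile is the
  zero function; for \<open>lam = a 0 * (real j)\<^sup>2\<close> the equation itself would hold
  there.\<close>

definition balanced :: "(real \<Rightarrow> real) \<Rightarrow> nat \<Rightarrow> real \<Rightarrow> bool" where
  "balanced a j \<mu> \<longleftrightarrow> 0 < \<mu> \<and> \<mu> < lam / 2 \<and> diffusivity j \<mu> = a (dirichlet j \<mu>)"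

lemma balanced_imp_less:
  assumes "mono a" "j \<ge> 1" "balanced a j \<mu>" shows "a 0 * (real j)\<^sup>2 < lam"
proof -
  have \<mu>: "0 < \<mu>" "\<mu> < lam / 2" "diffusivity j \<mu> = a (dirichlet j \<mu>)" using assms by (auto simp: balanced_def)
  have "a 0 \<le> a (dirichlet j \<mu>)"
    using dirichlet_mono[of 0 \<mu> j] \<mu> by (intro monoD[OF \<open>mono a\<close>]) (simp add: dirichlet_0)
  also have "\<dots> < lam / (real j)\<^sup>2"
    using diffusivity_strict_antimono[of 0 \<mu> j] \<mu> assms(2) by (simp add: diffusivity_0)
  finally show ?thesis using assms(2) by (simp add: pos_less_divide_eq)
qed

text \<open>All strictness comes from \<open>diffusivity\<close>; for the other side, monotone
  growth of \<open>dirichlet\<close> and of \<open>a\<close> is enough.\<close>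

lemma balanced_unique:
  assumes "mono a" "j \<ge> 1" "balanced a j \<mu>" "balanced a j \<nu>" shows "\<mu> = \<nu>"
proof -
  have False if "balanced a j \<mu>" "balanced a j \<nu>" "\<mu> < \<nu>" for \<mu> \<nu>
    using that diffusivity_strict_antimono[of \<mu> \<nu> j] monoD[OF \<open>mono a\<close> dirichlet_mono[of \<mu> \<nu> j]] \<open>j \<ge> 1\<close>
    by (auto simp: balanced_def)
  then show ?thesis using assms by (meson linorder_neqE_linordered_idom)
qed

lemma balanced_exists:
  assumes cont: "continuous_on UNIV a" and \<sigma>: "\<sigma> > 0" "\<And>t. a t \<ge> \<sigma>" and j: "j \<ge> 1"
    and less: "a 0 * (real j)\<^sup>2 < lam"
  shows "\<exists>\<mu>. balanced a j \<mu>"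
proof -
  have jpos: "real j > 0" using j by simp
  \<comment> \<open>Arches so long that \<open>diffusivity j \<nu> \<le> \<sigma>\<close>, hence at
    most any value of \<open>a\<close>: the lower bound on \<open>a\<close> supplies the second sign
    for the intermediate value theorem.\<close>
  obtain \<nu> where \<nu>: "0 < \<nu>" "\<nu> < lam / 2" "half_period \<nu> \<ge> pi / (real j * sqrt \<sigma>)"
    using half_period_unbounded by blast
  define g where "g \<mu> = a (dirichlet j \<mu>) - diffusivity j \<mu>" for \<mu>
  have g0: "g 0 < 0"
    using less jpos by (simp add: g_def dirichlet_0 diffusivity_0 pos_less_divide_eq)
  have "pi / (real j * half_period \<nu>) \<le> sqrt \<sigma>"
    using \<nu> jpos \<sigma> half_period_pos[of \<nu>] by (simp add: field_simps)
  then have "(pi / (real j * half_period \<nu>))\<^sup>2 \<le> (sqrt \<sigma>)\<^sup>2"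
    using \<nu> jpos half_period_pos[of \<nu>] by (intro power_mono) auto
  then have g1: "g \<nu> \<ge> 0" using \<sigma> by (simp add: g_def diffusivity_def) (metis order_trans)
  have sub: "{0..\<nu>} \<subseteq> {0..<lam/2}" using \<nu> by auto
  have cI: "continuous_on {0..\<nu>} half_period" by (rule continuous_on_subset[OF continuous_half_period sub])
  have ne: "\<forall>\<mu>\<in>{0..\<nu>}. real j * half_period \<mu> \<noteq> 0"
    using half_period_pos jpos sub by (force simp: less_imp_neq[symmetric])
  have cd: "continuous_on {0..\<nu>} (dirichlet j)"
    unfolding dirichlet_def using b_pos by (intro continuous_intros cI continuous_half_action) auto
  have "continuous_on {0..\<nu>} g"
    unfolding g_def diffusivity_def using ne
    by (intro continuous_intros cI continuous_on_compose2[OF cont cd]) auto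
  then obtain \<mu> where \<mu>: "0 \<le> \<mu>" "\<mu> \<le> \<nu>" "g \<mu> = 0"
    using IVT'[of g 0 0 \<nu>] g0 g1 \<nu> by auto
  then have "\<mu> \<noteq> 0" using g0 by auto
  then show ?thesis using \<mu> \<nu> by (auto simp: balanced_def g_def intro!: exI[of _ \<mu>])
qed

end

section \<open>Test functions\<close>

definition smooth :: "(real \<Rightarrow> real) \<Rightarrow> bool" where
  "smooth f \<longleftrightarrow> (\<forall>k. (deriv ^^ k) f differentiable_on UNIV)"

text \<open>Smoothness is a greatest fixed point: iterated derivatives never leave a family closed
  under differentiation, so no formula for them is required, only a suitable family.\<close>

lemma smooth_coinduct:
  assumes "f \<in> S"
    and step: "\<And>g. g \<in> S \<Longrightarrow> \<exists>g'\<in>S. \<forall>x. (g has_real_derivative g' x) (at x)"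
  shows "smooth f"
proof -
  have d: "g differentiable_on UNIV \<and> deriv g \<in> S" if gS: "g \<in> S" for g
  proof -
    obtain g' where g': "g' \<in> S" "\<And>x. (g has_real_derivative g' x) (at x)"
      using step[OF gS] by blast
    then have "deriv g = g'" by (auto intro!: DERIV_imp_deriv)
    moreover have "g differentiable_on UNIV"
      using g'(2) by (auto simp: differentiable_on_def real_differentiable_def)
    ultimately show ?thesis using g' by simp
  qed
  have "(deriv ^^ k) f \<in> S" for k
    by (induction k) (use assms(1) d in auto)
  then show ?thesis using d by (auto simp: smooth_def)
qed

lemma smooth_deriv: "smooth f \<Longrightarrow> smooth (deriv f)"
  unfolding smooth_def by (metis funpow_Suc_right comp_apply)

lemma smooth_DERIV:
  assumes "smooth f" shows "(f has_real_derivative deriv f x) (at x)"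
proof -
  have "f differentiable_on UNIV" using assms[unfolded smooth_def, rule_format, of 0] by simp
  then show ?thesis
    by (metis DERIV_deriv_iff_real_differentiable differentiable_on_eq_differentiable_at open_UNIV UNIV_I)
qed

lemma smooth_continuous: "smooth f \<Longrightarrow> continuous_on T f"
  by (meson DERIV_isCont continuous_at_imp_continuous_on smooth_DERIV)

lemma smooth_antideriv:
  assumes "\<And>x. (f has_real_derivative g x) (at x)" "smooth g"
  shows "smooth f"
proof (rule smooth_coinduct[where S = "insert f {g. smooth g}"])
  fix h assume "h \<in> insert f {g. smooth g}"
  then show "\<exists>g'\<in>insert f {g. smooth g}. \<forall>x. (h has_real_derivative g' x) (at x)"
  proof
    assume "h \<in> {g. smooth g}"
    then show ?thesis by (intro bexI[where x = "deriv h"]) (auto intro: smooth_deriv smooth_DERIV)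
  qed (use assms in auto)
qed simp

lemma smooth_const: "smooth (\<lambda>x. c)"
  by (rule smooth_coinduct[where S = "range (\<lambda>c x. c)"]) (auto intro!: DERIV_const)

lemma smooth_id: "smooth (\<lambda>x. x)"
  by (rule smooth_antideriv[OF DERIV_ident smooth_const])

lemma smooth_add:
  assumes "smooth f" "smooth g" shows "smooth (\<lambda>x. f x + g x)"
proof (rule smooth_coinduct[where S = "{\<lambda>x. f x + g x | f g. smooth f \<and> smooth g}"])
  fix h assume "h \<in> {\<lambda>x. f x + g x | f g. smooth f \<and> smooth g}"
  then obtain f g where h: "h = (\<lambda>x. f x + g x)" and s: "smooth f" "smooth g" by blast
  show "\<exists>g'\<in>{\<lambda>x. f x + g x |f g. smooth f \<and> smooth g}. \<forall>x. (h has_real_derivative g' x) (at x)"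
    by (rule bexI[where x = "\<lambda>x. deriv f x + deriv g x"])
       (use h s smooth_deriv in \<open>auto intro!: DERIV_add smooth_DERIV\<close>)
qed (use assms in blast)

text \<open>Contains all products of smooth functions and, by the Leibniz rule, is closed under differentiation.\<close>

inductive_set product_sums :: "(real \<Rightarrow> real) set" where
  prod: "smooth f \<Longrightarrow> smooth g \<Longrightarrow> (\<lambda>x. f x * g x) \<in> product_sums"
| add: "f \<in> product_sums \<Longrightarrow> g \<in> product_sums \<Longrightarrow> (\<lambda>x. f x + g x) \<in> product_sums"

lemma smooth_mult:
  assumes "smooth f" "smooth g" shows "smooth (\<lambda>x. f x * g x)"
proof (rule smooth_coinduct[where S = product_sums])
  fix h assume "h \<in> product_sums"
  then show "\<exists>g'\<in>product_sums. \<forall>x. (h has_real_derivative g' x) (at x)"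
  proof induction
    case (prod f g)
    have "(\<lambda>x. f x * deriv g x + deriv f x * g x) \<in> product_sums"
      using prod by (intro product_sums.intros smooth_deriv)
    moreover have "((\<lambda>x. f x * g x) has_real_derivative f x * deriv g x + deriv f x * g x) (at x)" for x
      using DERIV_mult'[OF smooth_DERIV[OF prod(1)] smooth_DERIV[OF prod(2)], of x] by simp
    ultimately show ?case by (intro bexI) auto
  next
    case (add f g)
    then obtain f' g' where "f' \<in> product_sums" "g' \<in> product_sums"
      "\<And>x. (f has_real_derivative f' x) (at x)" "\<And>x. (g has_real_derivative g' x) (at x)"
      by blast
    then show ?case
      by (intro bexI[where x = "\<lambda>x. f' x + g' x"]) (auto intro: DERIV_add product_sums.add)
  qed
qed (use assms product_sums.prod in blast)

lemma smooth_cmult: "smooth f \<Longrightarrow> smooth (\<lambda>x. c * f x)"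
  by (intro smooth_mult smooth_const)

lemma smooth_diff:
  assumes "smooth f" "smooth g" shows "smooth (\<lambda>x. f x - g x)"
  using smooth_add[OF assms(1) smooth_cmult[OF assms(2), of "-1"]] by simp

text \<open>The constant \<open>C\<close> in the family absorbs the factor \<open>c\<close> that
  each differentiation brings out.\<close>

lemma smooth_affine:
  assumes "smooth f" shows "smooth (\<lambda>x. f (c * x + d))"
proof (rule smooth_coinduct[where S = "{\<lambda>x. C * g (c * x + d) | C g. smooth g}"])
  show "(\<lambda>x. f (c * x + d)) \<in> {\<lambda>x. C * g (c * x + d) | C g. smooth g}"
    using assms by (auto intro!: exI[where x=1] exI[where x=f])
next
  fix h assume "h \<in> {\<lambda>x. C * g (c * x + d) | C g. smooth g}"
  then obtain C g where h: "h = (\<lambda>x. C * g (c * x + d))" and g: "smooth g" by blast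
  have "(h has_real_derivative (C * c) * deriv g (c * x + d)) (at x)" for x
    unfolding h
    by (rule derivative_eq_intros DERIV_chain2[OF smooth_DERIV[OF g]] refl | simp)+
  then show "\<exists>g'\<in>{\<lambda>x. C * g (c * x + d) | C g. smooth g}. \<forall>x. (h has_real_derivative g' x) (at x)"
    using smooth_deriv[OF g] by (intro bexI[where x = "\<lambda>x. (C * c) * deriv g (c * x + d)"]) blast+
qed

lemma smooth_real_polynomial:
  fixes f :: "real \<Rightarrow> real"
  shows "real_polynomial_function f \<Longrightarrow> smooth f"
proof (induction rule: real_polynomial_function.induct)
  case (linear f)
  have "f x = f 1 * x" for x
    using linear_scale[OF bounded_linear.linear[OF linear], of x 1] by simp
  then have "f = (\<lambda>x. f 1 * x)" by blast
  then show ?case using smooth_cmult[OF smooth_id, of "f 1"] by metis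
qed (fact smooth_const, rule smooth_add, assumption+, rule smooth_mult, assumption+)

definition flat :: "real poly \<Rightarrow> real \<Rightarrow> real" where
  "flat p x = (if x > 0 then poly p (1/x) * exp (- (1/x)) else 0)"

lemma poly_times_exp_tendsto_0: "((\<lambda>y::real. poly p y * exp (-y)) \<longlongrightarrow> 0) at_top"
proof -
  have eq: "poly p y * exp (-y) = (\<Sum>i\<le>degree p. coeff p i * (y ^ i / exp y))" for y :: real
    by (simp add: poly_altdef exp_minus sum_distrib_right divide_inverse mult.assoc)
  have "((\<lambda>y::real. \<Sum>i\<le>degree p. coeff p i * (y ^ i / exp y)) \<longlongrightarrow> (\<Sum>i\<le>degree p. coeff p i * 0)) at_top"
    by (intro tendsto_intros tendsto_power_div_exp_0)
  then show ?thesis by (simp add: eq)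
qed

lemma flat_tendsto_0: "(flat p \<longlongrightarrow> 0) (at 0)"
proof -
  have "((\<lambda>x::real. poly p (1/x) * exp (- (1/x))) \<longlongrightarrow> 0) (at_right 0)"
    using filterlim_compose[OF poly_times_exp_tendsto_0[of p] filterlim_inverse_at_top_right]
    by (simp add: inverse_eq_divide)
  then have "(flat p \<longlongrightarrow> 0) (at_right 0)"
    by (rule Lim_transform_eventually) (auto simp: flat_def eventually_at_right_field intro: exI[where x=1])
  moreover have "(flat p \<longlongrightarrow> 0) (at_left 0)"
    by (rule tendsto_eventually) (auto simp: flat_def eventually_at_left_field intro: exI[where x="-1"])
  ultimately show ?thesis by (simp add: filterlim_at_split)
qed

text \<open>In the variable \<open>y = 1/x\<close>, whose derivative is \<open>- y^2\<close>,
  differentiation replaces \<open>p\<close> by \<open>y^2\<close> times \<open>p - pderiv p\<close>;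
  the list \<open>[:0, 0, 1:]\<close> is \<open>y^2\<close>.\<close>

lemma DERIV_flat: "(flat p has_real_derivative flat ([:0, 0, 1:] * (p - pderiv p)) x) (at x)"
proof -
  consider "x > 0" | "x = 0" | "x < 0" by linarith
  then show ?thesis
  proof cases
    case 1
    have "((\<lambda>x. poly p (1/x) * exp (- (1/x))) has_real_derivative
        flat ([:0, 0, 1:] * (p - pderiv p)) x) (at x)"
      using 1 by (auto intro!: derivative_eq_intros DERIV_chain2[OF poly_DERIV]
        simp: flat_def field_simps power2_eq_square)
    then show ?thesis
      by (rule has_field_derivative_transform_within_open[where S="{0<..}"]) (use 1 in \<open>auto simp: flat_def\<close>)
  next
    case 2
    \<comment> \<open>Dividing by \<open>h\<close> is multiplying by \<open>y = 1/h\<close>, so the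
      difference quotient at 0 is again a member of the family and tends to 0.\<close>
    have "(flat p (0 + h) - flat p 0) / h = flat ([:0, 1:] * p) h" for h by (simp add: flat_def)
    moreover have "flat ([:0, 0, 1:] * (p - pderiv p)) 0 = 0" by (simp add: flat_def)
    ultimately show ?thesis using 2 flat_tendsto_0[of "[:0, 1:] * p"] by (simp only: DERIV_def)
  next
    case 3
    have "((\<lambda>x. 0) has_real_derivative flat ([:0, 0, 1:] * (p - pderiv p)) x) (at x)"
      using 3 by (simp add: flat_def)
    then show ?thesis
      by (rule has_field_derivative_transform_within_open[where S="{..<0}"]) (use 3 in \<open>auto simp: flat_def\<close>)
  qed
qed

lemma smooth_flat: "smooth (flat p)"
  by (rule smooth_coinduct[where S = "range flat"]) (use DERIV_flat in blast)+

lemma DERIV_zero_on_interval_eq: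
  fixes F :: "real \<Rightarrow> real"
  assumes "\<And>x. (F has_real_derivative f x) (at x)" "\<And>x. a < x \<Longrightarrow> x < b \<Longrightarrow> f x = 0" "a \<le> b"
  shows "F a = F b"
proof (cases "a = b")
  case False
  then show ?thesis
    using DERIV_isconst_end[of a b F] assms DERIV_isCont
    by (metis continuous_at_imp_continuous_on less_le)
qed simp

text \<open>The product of \<open>flat 1 x\<close> and \<open>flat 1 (1 - x)\<close> is a bump on
  the unit interval; its primitive, divided by the total mass, is the step.\<close>

lemma smooth_step_exists:
  obtains s where "smooth s" "\<And>x. x \<le> 0 \<Longrightarrow> s x = 0" "\<And>x. x \<ge> 1 \<Longrightarrow> s x = 1"
    "\<And>x. 0 \<le> s x" "\<And>x. s x \<le> 1"
proof -
  define b where "b x = flat 1 x * flat 1 (- 1 * x + 1)" for x :: real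
  have sb: "smooth b" unfolding b_def by (intro smooth_mult smooth_flat smooth_affine)
  have b0: "b x = 0" if "x \<le> 0 \<or> x \<ge> 1" for x using that by (auto simp: b_def flat_def)
  have bpos: "b x > 0" if "0 < x" "x < 1" for x using that by (simp add: b_def flat_def)
  have bnn: "b x \<ge> 0" for x using b0[of x] bpos[of x] by linarith
  obtain B where B0: "B 0 = 0" and B: "\<And>x. (B has_real_derivative b x) (at x)"
    using exists_antiderivative[OF smooth_continuous[OF sb]] by blast
  have mono: "B x \<le> B y" if "x \<le> y" for x y
    using that B bnn by (meson DERIV_nonneg_imp_nondecreasing)
  have le: "B x = 0" if "x \<le> 0" for x
    using DERIV_zero_on_interval_eq[OF B, of x 0] b0 that B0 by auto
  have ge: "B x = B 1" if "x \<ge> 1" for x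
    using DERIV_zero_on_interval_eq[OF B, of 1 x] b0 that by auto
  have pos: "B 1 > 0"
    using DERIV_pos_imp_increasing_open[of 0 1 B] B bpos B0
    by (metis DERIV_isCont continuous_at_imp_continuous_on zero_less_one)
  show ?thesis
  proof (rule that[of "\<lambda>x. (1 / B 1) * B x"])
    show "smooth (\<lambda>x. (1 / B 1) * B x)" by (intro smooth_cmult smooth_antideriv[OF B sb])
    fix x
    have "0 \<le> B x" using mono[of 0 x] le[of x] B0 by linarith
    then show "0 \<le> 1 / B 1 * B x" using pos by simp
    have "B x \<le> B 1" using mono[of x 1] ge[of x] by linarith
    then show "1 / B 1 * B x \<le> 1" using pos by simp
    show "x \<le> 0 \<Longrightarrow> 1 / B 1 * B x = 0" using le[of x] by simp
    show "x \<ge> 1 \<Longrightarrow> 1 / B 1 * B x = 1" using ge[of x] pos by simp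
  qed
qed

section \<open>Test functions on the interval: supports, plateaus, primitives\<close>

lemma test_functionsI:
  assumes "smooth \<phi>" "0 < \<alpha>" "\<beta> < pi" "\<And>x. x \<le> \<alpha> \<or> x \<ge> \<beta> \<Longrightarrow> \<phi> x = 0"
  shows "\<phi> \<in> test_functions"
proof -
  have "\<exists>K. compact K \<and> K \<subseteq> {0<..<pi} \<and> (\<forall>x. x \<notin> K \<longrightarrow> \<phi> x = 0)"
    by (rule exI[where x="{\<alpha>..\<beta>}"]) (use assms in auto)
  then show ?thesis using assms(1) by (simp add: test_functions_def smooth_def)
qed

lemma test_functionsE:
  assumes "\<phi> \<in> test_functions"
  obtains \<alpha> \<beta> where "smooth \<phi>" "0 < \<alpha>" "\<alpha> < \<beta>" "\<beta> < pi" "\<And>x. x \<le> \<alpha> \<or> x \<ge> \<beta> \<Longrightarrow> \<phi> x = 0"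
proof -
  obtain K where K: "compact K" "K \<subseteq> {0<..<pi}" "\<And>x. x \<notin> K \<Longrightarrow> \<phi> x = 0" and s: "smooth \<phi>"
    using assms by (auto simp: test_functions_def smooth_def)
  \<comment> \<open>Two interior points are added so that the set is nonempty and its extremes are
    distinct even if \<phi> vanishes. The cutting points are then taken halfway to 0 and
    \<open>pi\<close>, hence outside the support.\<close>
  let ?K = "insert 1 (insert 2 K)"
  have K': "compact ?K" "?K \<subseteq> {0<..<pi}" "?K \<noteq> {}" using K pi_gt3 by auto
  obtain l where l: "l \<in> ?K" "\<And>t. t \<in> ?K \<Longrightarrow> l \<le> t"
    using compact_attains_inf[OF K'(1,3)] by blast
  obtain m where m: "m \<in> ?K" "\<And>t. t \<in> ?K \<Longrightarrow> t \<le> m"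
    using compact_attains_sup[OF K'(1,3)] by blast
  have lm: "0 < l" "m < pi" "l \<le> 1" "2 \<le> m" using l m K'(2) by auto
  show ?thesis
  proof (rule that[of "l / 2" "(m + pi) / 2"])
    show "\<phi> x = 0" if "x \<le> l / 2 \<or> x \<ge> (m + pi) / 2" for x
      using that K(3)[of x] l(2)[of x] m(2)[of x] lm by fastforce
  qed (use s lm in auto)
qed

lemma test_deriv:
  assumes "\<phi> \<in> test_functions" shows "deriv \<phi> \<in> test_functions"
proof -
  obtain \<alpha> \<beta> where *: "smooth \<phi>" "0 < \<alpha>" "\<alpha> < \<beta>" "\<beta> < pi" "\<And>x. x \<le> \<alpha> \<or> x \<ge> \<beta> \<Longrightarrow> \<phi> x = 0"
    using test_functionsE[OF assms] by metis
  show ?thesis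
  proof (rule test_functionsI)
    \<comment> \<open>The margins move outwards, since the derivative is seen to vanish where \<phi>
      vanishes on a neighbourhood.\<close>
    fix x assume x: "x \<le> \<alpha>/2 \<or> x \<ge> (\<beta>+pi)/2"
    have "(\<phi> has_real_derivative 0) (at x)"
      by (rule has_field_derivative_transform_within_open[where S="{..<\<alpha>} \<union> {\<beta><..}" and f="\<lambda>x. 0"])
         (use * x in auto)
    then show "deriv \<phi> x = 0" by (rule DERIV_imp_deriv)
  qed (use * smooth_deriv in auto)
qed

lemma test_bounded:
  assumes "\<phi> \<in> test_functions" obtains B where "\<And>x. \<bar>\<phi> x\<bar> \<le> B"
proof -
  obtain \<alpha> \<beta> where *: "smooth \<phi>" "0 < \<alpha>" "\<alpha> < \<beta>" "\<beta> < pi" "\<And>x. x \<le> \<alpha> \<or> x \<ge> \<beta> \<Longrightarrow> \<phi> x = 0"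
    using test_functionsE[OF assms] by metis
  have "compact (\<phi> ` {\<alpha>..\<beta>})" using * by (intro compact_continuous_image smooth_continuous) auto
  then obtain B where B: "\<And>x. x \<in> {\<alpha>..\<beta>} \<Longrightarrow> \<bar>\<phi> x\<bar> \<le> B"
    using compact_imp_bounded[of "\<phi> ` {\<alpha>..\<beta>}"] by (auto simp: bounded_iff simp del: atLeastAtMost_iff)
  have "\<bar>\<phi> x\<bar> \<le> max B 0" for x
    using B[of x] *(5)[of x] by (cases "x \<in> {\<alpha>..\<beta>}") auto
  then show ?thesis using that by blast
qed

lemma test_continuous: "\<phi> \<in> test_functions \<Longrightarrow> continuous_on T \<phi>"
  by (metis test_functionsE smooth_continuous)

lemma test_DERIV: "\<phi> \<in> test_functions \<Longrightarrow> (\<phi> has_real_derivative deriv \<phi> x) (at x)"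
  by (metis test_functionsE smooth_DERIV)

lemma test_diff_cmult:
  assumes "\<phi> \<in> test_functions" "\<psi> \<in> test_functions"
  shows "(\<lambda>x. \<phi> x - c * \<psi> x) \<in> test_functions"
proof -
  obtain \<alpha> \<beta> where 1: "smooth \<phi>" "0 < \<alpha>" "\<beta> < pi" "\<And>x. x \<le> \<alpha> \<or> x \<ge> \<beta> \<Longrightarrow> \<phi> x = 0"
    using test_functionsE[OF assms(1)] by metis
  obtain \<alpha>' \<beta>' where 2: "smooth \<psi>" "0 < \<alpha>'" "\<beta>' < pi" "\<And>x. x \<le> \<alpha>' \<or> x \<ge> \<beta>' \<Longrightarrow> \<psi> x = 0"
    using test_functionsE[OF assms(2)] by metis
  show ?thesis
    by (rule test_functionsI[where \<alpha>="min \<alpha> \<alpha>'" and \<beta>="max \<beta> \<beta>'"])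
       (use 1 2 in \<open>auto intro!: smooth_diff smooth_cmult\<close>)
qed

lemma test_smooth_mult:
  assumes "\<phi> \<in> test_functions" "smooth p"
  shows "(\<lambda>x. \<phi> x * p x) \<in> test_functions"
proof -
  obtain \<alpha> \<beta> where 1: "smooth \<phi>" "0 < \<alpha>" "\<beta> < pi" "\<And>x. x \<le> \<alpha> \<or> x \<ge> \<beta> \<Longrightarrow> \<phi> x = 0"
    using test_functionsE[OF assms(1)] by metis
  show ?thesis
    by (rule test_functionsI[of _ \<alpha> \<beta>]) (use 1 assms(2) in \<open>auto intro!: smooth_mult\<close>)
qed

text \<open>A step rising on the first \<open>1/c\<close> of the interval minus one rising on the
  last \<open>1/c\<close>. By \<open>c * (\<beta> - \<alpha>) \<ge> 1\<close> the second has not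
  begun at \<alpha> and the first is complete at \<beta>.\<close>

lemma plateau_exists:
  assumes c: "0 < c" "c * (\<beta> - \<alpha>) \<ge> 1"
  obtains \<psi> where "smooth \<psi>" "\<And>x. x \<le> \<alpha> \<or> x \<ge> \<beta> \<Longrightarrow> \<psi> x = 0" "\<And>x. \<bar>\<psi> x\<bar> \<le> 1"
    "\<And>x. \<alpha> + 1/c \<le> x \<Longrightarrow> x \<le> \<beta> - 1/c \<Longrightarrow> \<psi> x = 1"
proof -
  obtain s where s: "smooth s" "\<And>x. x \<le> 0 \<Longrightarrow> s x = 0" "\<And>x. x \<ge> 1 \<Longrightarrow> s x = 1"
    "\<And>x. 0 \<le> s x" "\<And>x. s x \<le> 1"
    using smooth_step_exists by metis
  define \<psi> where "\<psi> x = s (c * x + (- c * \<alpha>)) - s (c * x + (1 - c * \<beta>))" for x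
  show ?thesis
  proof (rule that[of \<psi>])
    show "smooth \<psi>" unfolding \<psi>_def by (intro smooth_diff smooth_affine s)
    show "\<psi> x = 0" if "x \<le> \<alpha> \<or> x \<ge> \<beta>" for x
      using that
    proof
      assume "x \<le> \<alpha>"
      then have "c * x \<le> c * \<alpha>" using c by simp
      then show ?thesis using s(2) c(2) by (simp add: \<psi>_def algebra_simps)
    next
      assume "x \<ge> \<beta>"
      then have "c * x \<ge> c * \<beta>" using c by simp
      then show ?thesis using s(3) c(2) by (simp add: \<psi>_def algebra_simps)
    qed
    show "\<bar>\<psi> x\<bar> \<le> 1" for x
      using s(4,5)[of "c * x + (- c * \<alpha>)"] s(4,5)[of "c * x + (1 - c * \<beta>)"] by (simp add: \<psi>_def)
    show "\<psi> x = 1" if "\<alpha> + 1/c \<le> x" "x \<le> \<beta> - 1/c" for x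
    proof -
      have "c * (\<alpha> + 1/c) \<le> c * x" "c * x \<le> c * (\<beta> - 1/c)" using that c by auto
      then have "c * x + (- c * \<alpha>) \<ge> 1" "c * x + (1 - c * \<beta>) \<le> 0" using c by (auto simp: algebra_simps)
      then show ?thesis using s(2,3) by (simp add: \<psi>_def)
    qed
  qed
qed

lemma test_plateaus:
  assumes "0 \<le> \<alpha>" "\<alpha> < \<beta>" "\<beta> \<le> pi"
  obtains \<psi> where "\<And>n. \<psi> n \<in> test_functions" "\<And>n x. \<bar>\<psi> n x\<bar> \<le> 1"
    "\<And>x. (\<lambda>n. \<psi> n x) \<longlonglongrightarrow> indicator {\<alpha><..<\<beta>} x"
proof -
  define d where "d = \<beta> - \<alpha>"
  \<comment> \<open>\<open>e n\<close> is both the margin and the width of a transition. The offset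
    3 leaves \<open>d / e n - 2 = real n + 1\<close> transition widths between the margins, at least
    the one demanded by the plateau construction.\<close>
  define e where "e n = d / (real n + 3)" for n
  have d: "d > 0" using assms by (simp add: d_def)
  have e: "e n > 0" for n using d by (simp add: e_def)
  have "\<exists>\<psi>. smooth \<psi> \<and> (\<forall>x. x \<le> \<alpha> + e n \<or> x \<ge> \<beta> - e n \<longrightarrow> \<psi> x = 0) \<and> (\<forall>x. \<bar>\<psi> x\<bar> \<le> 1) \<and>
    (\<forall>x. \<alpha> + e n + e n \<le> x \<longrightarrow> x \<le> \<beta> - e n - e n \<longrightarrow> \<psi> x = 1)" for n
  proof -
    have "1 / e n * ((\<beta> - e n) - (\<alpha> + e n)) = d / e n - 2"
      using e[of n] by (simp add: d_def field_simps)
    also have "\<dots> = real n + 1" using d by (simp add: e_def)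
    finally have "1 / e n * ((\<beta> - e n) - (\<alpha> + e n)) \<ge> 1" by simp
    then obtain \<psi> where "smooth \<psi>" "\<And>x. x \<le> \<alpha> + e n \<or> x \<ge> \<beta> - e n \<Longrightarrow> \<psi> x = 0" "\<And>x. \<bar>\<psi> x\<bar> \<le> 1"
      "\<And>x. \<alpha> + e n + 1 / (1 / e n) \<le> x \<Longrightarrow> x \<le> \<beta> - e n - 1 / (1 / e n) \<Longrightarrow> \<psi> x = 1"
      using plateau_exists[of "1 / e n" "\<beta> - e n" "\<alpha> + e n"] e[of n] by (metis zero_less_divide_1_iff)
    then show ?thesis by (intro exI[of _ \<psi>]) simp
  qed
  then obtain \<psi> where \<psi>: "\<And>n. smooth (\<psi> n)" "\<And>n x. x \<le> \<alpha> + e n \<or> x \<ge> \<beta> - e n \<Longrightarrow> \<psi> n x = 0"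
    "\<And>n x. \<bar>\<psi> n x\<bar> \<le> 1" "\<And>n x. \<alpha> + e n + e n \<le> x \<Longrightarrow> x \<le> \<beta> - e n - e n \<Longrightarrow> \<psi> n x = 1"
    by metis
  have e0: "e \<longlonglongrightarrow> 0"
    unfolding e_def
    by (rule real_tendsto_divide_at_top[OF tendsto_const])
       (intro filterlim_tendsto_add_at_top[OF tendsto_const, of _ _ 3, simplified add.commute] filterlim_real_sequentially)
  show ?thesis
  proof (rule that[of \<psi>])
    show "\<psi> n \<in> test_functions" for n
      by (rule test_functionsI[where \<alpha>="\<alpha> + e n" and \<beta>="\<beta> - e n"])
         (use \<psi> e[of n] assms in auto)
    show "(\<lambda>n. \<psi> n x) \<longlonglongrightarrow> indicator {\<alpha><..<\<beta>} x" for x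
    proof (cases "x \<in> {\<alpha><..<\<beta>}")
      case True
      define r where "r = min (x - \<alpha>) (\<beta> - x) / 2"
      have "r > 0" using True by (simp add: r_def)
      then have "\<forall>\<^sub>F n in sequentially. e n < r" using e0 order_tendstoD(2) by blast
      then have "\<forall>\<^sub>F n in sequentially. \<psi> n x = 1"
        by eventually_elim (rule \<psi>(4), auto simp: r_def min_def split: if_splits)
      then show ?thesis using True by (simp add: tendsto_eventually)
    next
      case False
      then have "\<psi> n x = 0" for n using \<psi>(2)[of x n] e[of n] by fastforce
      then show ?thesis using False by simp
    qed
  qed (rule \<psi>(3))
qed

text \<open>The primitive that vanishes to the left of the support is constant to its right, and
  zero mean makes that constant 0.\<close>

lemma test_antiderivative:
  assumes "\<psi> \<in> test_functions" "integral {0..pi} \<psi> = 0"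
  obtains \<phi> where "\<phi> \<in> test_functions" "deriv \<phi> = \<psi>"
proof -
  obtain \<alpha> \<beta> where *: "smooth \<psi>" "0 < \<alpha>" "\<alpha> < \<beta>" "\<beta> < pi" "\<And>x. x \<le> \<alpha> \<or> x \<ge> \<beta> \<Longrightarrow> \<psi> x = 0"
    using test_functionsE[OF assms(1)] by metis
  obtain F where F: "F 0 = 0" "\<And>x. (F has_real_derivative \<psi> x) (at x)"
    using exists_antiderivative[OF smooth_continuous[OF *(1)]] by blast
  have "(\<psi> has_integral F pi - F 0) {0..pi}"
    using F(2) by (intro fundamental_theorem_of_calculus)
      (auto simp: has_real_derivative_iff_has_vector_derivative[symmetric] intro: has_field_derivative_at_within)
  then have Fpi: "F pi = 0" using assms(2) F(1) by (simp add: integral_unique)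
  have F0: "F x = 0" if "x \<le> \<alpha> \<or> x \<ge> \<beta>" for x
    using that
  proof
    assume "x \<le> \<alpha>"
    then have "F (min x 0) = F 0" "F (min x 0) = F x"
      using DERIV_zero_on_interval_eq[OF F(2), of "min x 0" 0] DERIV_zero_on_interval_eq[OF F(2), of "min x 0" x]
        *(2,5) by auto
    then show ?thesis using F by simp
  next
    assume "x \<ge> \<beta>"
    then have "F pi = F (max x pi)" "F x = F (max x pi)"
      using DERIV_zero_on_interval_eq[OF F(2), of pi "max x pi"] DERIV_zero_on_interval_eq[OF F(2), of x "max x pi"]
        *(4,5) by auto
    then show ?thesis using Fpi by simp
  qed
  show ?thesis
  proof (rule that[of F])
    show "F \<in> test_functions"
      by (rule test_functionsI[OF smooth_antideriv[OF F(2) *(1)] *(2,4)]) (use F0 in auto)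
    show "deriv F = \<psi>" using F(2) by (auto intro!: DERIV_imp_deriv)
  qed
qed

text \<open>The derivative of a smooth step climbing from 0 to 1 between 1 and 2, well inside the
  interval as \<open>pi > 3\<close>.\<close>

lemma test_unit_mass:
  obtains \<rho> where "\<rho> \<in> test_functions" "integral {0..pi} \<rho> = 1"
proof -
  obtain s where s: "smooth s" "\<And>x. x \<le> 0 \<Longrightarrow> s x = 0" "\<And>x. x \<ge> 1 \<Longrightarrow> s x = 1"
    "\<And>x. 0 \<le> s x" "\<And>x. s x \<le> 1"
    using smooth_step_exists by metis
  define t where "t x = s (1 * x + (-1))" for x
  have t: "smooth t" unfolding t_def by (intro smooth_affine s)
  have pi3: "pi > 3" by (rule pi_gt3)
  show ?thesis
  proof (rule that[of "deriv t"])
    show "deriv t \<in> test_functions"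
    proof (rule test_functionsI[OF smooth_deriv[OF t], of "1/2" 3])
      fix x :: real assume x: "x \<le> 1/2 \<or> x \<ge> 3"
      have "(t has_real_derivative 0) (at x)"
        using x
      proof
        assume x: "x \<le> 1/2"
        show ?thesis
          by (rule has_field_derivative_transform_within_open[where S="{..<1}" and f="\<lambda>x. 0"])
             (use x in \<open>auto simp: t_def s\<close>)
      next
        assume x: "x \<ge> 3"
        show ?thesis
          by (rule has_field_derivative_transform_within_open[where S="{2<..}" and f="\<lambda>x. 1"])
             (use x in \<open>auto simp: t_def s\<close>)
      qed
      then show "deriv t x = 0" by (rule DERIV_imp_deriv)
    qed (use pi3 in auto)
    have "(deriv t has_integral t pi - t 0) {0..pi}"
      using smooth_DERIV[OF t] by (intro fundamental_theorem_of_calculus)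
        (auto simp: has_real_derivative_iff_has_vector_derivative[symmetric] intro: has_field_derivative_at_within)
    moreover have "t pi = 1" "t 0 = 0" using pi3 by (auto simp: t_def s)
    ultimately show "integral {0..pi} (deriv t) = 1" by (simp add: integral_unique)
  qed
qed

section \<open>Weak and classical solutions\<close>

lemma interval_sets [simp]: "{0<..<pi} \<in> sets lebesgue" by simp

lemma finite_interval_measure: "finite_measure interval_measure_0_pi"
  by (rule finite_measure_lebesgue_on) auto

lemma measurable_continuous_interval:
  fixes f :: "real \<Rightarrow> real"
  assumes "continuous_on {0..pi} f" shows "f \<in> borel_measurable interval_measure_0_pi"
  by (rule continuous_imp_measurable_on_sets_lebesgue)
     (auto intro: continuous_on_subset[OF assms])

lemma integrable_times_bounded:
  fixes w f :: "real \<Rightarrow> real"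
  assumes "integrable interval_measure_0_pi w" "f \<in> borel_measurable interval_measure_0_pi"
    "\<And>x. x \<in> {0<..<pi} \<Longrightarrow> \<bar>f x\<bar> \<le> B"
  shows "integrable interval_measure_0_pi (\<lambda>x. w x * f x)"
proof (rule Bochner_Integration.integrable_bound)
  show "integrable interval_measure_0_pi (\<lambda>x. B * w x)" using assms(1) by simp
  show "(\<lambda>x. w x * f x) \<in> borel_measurable interval_measure_0_pi"
    using assms(1,2) by (intro borel_measurable_times) auto
  show "AE x in interval_measure_0_pi. norm (w x * f x) \<le> norm (B * w x)"
  proof (rule AE_I2)
    fix x assume "x \<in> space interval_measure_0_pi"
    then have "\<bar>f x\<bar> \<le> \<bar>B\<bar>" using assms(3)[of x] by (auto simp: space_restrict_space)
    then show "norm (w x * f x) \<le> norm (B * w x)"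
      by (simp add: abs_mult mult.commute mult_right_mono)
  qed
qed

lemma integrable_continuous_interval:
  fixes f :: "real \<Rightarrow> real"
  assumes "continuous_on {0..pi} f" shows "integrable interval_measure_0_pi f"
proof -
  have "compact (f ` {0..pi})" by (intro compact_continuous_image assms) auto
  then obtain B where B: "\<And>x. x \<in> {0..pi} \<Longrightarrow> \<bar>f x\<bar> \<le> B"
    using compact_imp_bounded[of "f ` {0..pi}"] by (auto simp: bounded_iff simp del: atLeastAtMost_iff)
  have "integrable interval_measure_0_pi (\<lambda>x. 1 * f x)"
    by (rule integrable_times_bounded[where B=B])
       (use B measurable_continuous_interval[OF assms] finite_measure.integrable_const[OF finite_interval_measure] in auto)
  then show ?thesis by simp
qed

lemma LINT_continuous_interval:
  fixes f :: "real \<Rightarrow> real"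
  assumes "continuous_on {0..pi} f"
  shows "(LINT x|interval_measure_0_pi. f x) = integral {0..pi} f"
  using lebesgue_integral_eq_integral[OF integrable_continuous_interval[OF assms] interval_sets]
  by (simp add: integral_open_interval_real)

lemma L2_integrable:
  assumes "w \<in> L2" shows "integrable interval_measure_0_pi w"
proof (rule Bochner_Integration.integrable_bound)
  show "integrable interval_measure_0_pi (\<lambda>x. 1 + (w x)\<^sup>2)"
    by (intro Bochner_Integration.integrable_add finite_measure.integrable_const[OF finite_interval_measure])
       (use assms in \<open>simp add: L2_def\<close>)
  show "w \<in> borel_measurable interval_measure_0_pi" using assms by (simp add: L2_def)
  have "\<bar>t\<bar> \<le> \<bar>1 + t\<^sup>2\<bar>" for t :: real
  proof -
    have "0 \<le> (\<bar>t\<bar> - 1)\<^sup>2" by simp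
    then have "2 * \<bar>t\<bar> \<le> 1 + t\<^sup>2" by (simp add: power2_diff)
    then show ?thesis by simp
  qed
  then show "AE x in interval_measure_0_pi. norm (w x) \<le> norm (1 + (w x)\<^sup>2)" by simp
qed

lemma L2_continuous:
  assumes "continuous_on {0..pi} f" shows "f \<in> L2"
  using assms by (auto simp: L2_def intro!: measurable_continuous_interval integrable_continuous_interval continuous_intros)

lemma integrable_times_test:
  assumes "integrable interval_measure_0_pi w" "\<phi> \<in> test_functions"
  shows "integrable interval_measure_0_pi (\<lambda>x. w x * \<phi> x)"
proof -
  obtain B where "\<And>x. \<bar>\<phi> x\<bar> \<le> B" using test_bounded[OF assms(2)] by blast
  then show ?thesis
    by (intro integrable_times_bounded[OF assms(1)] measurable_continuous_interval test_continuous[OF assms(2)])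
qed

text \<open>Plateaus converge pointwise to the indicator of the subinterval, and the absolute value
  of \<open>w\<close> dominates the products.\<close>

lemma integral_subinterval_zero:
  fixes w :: "real \<Rightarrow> real"
  assumes w: "integrable interval_measure_0_pi w"
    and 0: "\<And>\<psi>. \<psi> \<in> test_functions \<Longrightarrow> (LINT x|interval_measure_0_pi. w x * \<psi> x) = 0"
    and \<alpha>\<beta>: "0 \<le> \<alpha>" "\<alpha> < \<beta>" "\<beta> \<le> pi"
  shows "integral {\<alpha>..\<beta>} w = 0"
proof -
  obtain \<psi> where \<psi>: "\<And>n. \<psi> n \<in> test_functions" "\<And>n x. \<bar>\<psi> n x\<bar> \<le> 1"
    "\<And>x. (\<lambda>n. \<psi> n x) \<longlonglongrightarrow> indicator {\<alpha><..<\<beta>} x"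
    using test_plateaus[OF \<alpha>\<beta>] by metis
  have ind: "(indicator {\<alpha><..<\<beta>} :: real \<Rightarrow> real) \<in> borel_measurable interval_measure_0_pi"
    by (intro borel_measurable_indicator) (use \<alpha>\<beta> in \<open>auto simp: sets_restrict_space_iff\<close>)
  have mw: "w \<in> borel_measurable interval_measure_0_pi" using w by auto
  have "(\<lambda>n. LINT x|interval_measure_0_pi. w x * \<psi> n x) \<longlonglongrightarrow>
    (LINT x|interval_measure_0_pi. w x * indicator {\<alpha><..<\<beta>} x)"
  proof (rule integral_dominated_convergence[where w="\<lambda>x. \<bar>w x\<bar>"])
    show "(\<lambda>x. w x * indicator {\<alpha><..<\<beta>} x) \<in> borel_measurable interval_measure_0_pi"
      by (intro borel_measurable_times mw ind)
    show "(\<lambda>x. w x * \<psi> n x) \<in> borel_measurable interval_measure_0_pi" for n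
      by (intro borel_measurable_times mw measurable_continuous_interval test_continuous \<psi>)
    show "AE x in interval_measure_0_pi. (\<lambda>n. w x * \<psi> n x) \<longlonglongrightarrow> w x * indicator {\<alpha><..<\<beta>} x"
      by (intro AE_I2 tendsto_mult_left \<psi>)
    show "AE x in interval_measure_0_pi. norm (w x * \<psi> n x) \<le> \<bar>w x\<bar>" for n
      using mult_left_mono[OF \<psi>(2)[of n] abs_ge_zero, of "w _"] by (intro AE_I2) (simp add: abs_mult)
  qed (use w in auto)
  then have z: "(LINT x|interval_measure_0_pi. w x * indicator {\<alpha><..<\<beta>} x) = 0"
    using 0[OF \<psi>(1)] by (simp add: LIMSEQ_const_iff)
  have sub: "{\<alpha><..<\<beta>} \<subseteq> {0<..<pi}" using \<alpha>\<beta> by auto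
  have "(LINT x|interval_measure_0_pi. w x * indicator {\<alpha><..<\<beta>} x) =
     (LINT x|interval_measure_0_pi. (if x \<in> {\<alpha><..<\<beta>} then w x else 0))"
    by (rule Bochner_Integration.integral_cong) (auto simp: indicator_def)
  also have "\<dots> = (LINT x|lebesgue_on {\<alpha><..<\<beta>}. w x)"
    by (rule Lebesgue_Measure.integral_restrict) (use sub in auto)
  also have "\<dots> = integral {\<alpha><..<\<beta>} w"
  proof (rule lebesgue_integral_eq_integral)
    have "integrable interval_measure_0_pi (\<lambda>x. w x * indicator {\<alpha><..<\<beta>} x)"
      by (rule integrable_times_bounded[OF w ind, of 1]) (auto simp: indicator_def)
    then have "integrable lebesgue (\<lambda>x. if x \<in> {0<..<pi} then w x * indicator {\<alpha><..<\<beta>} x else 0)"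
      by (subst Lebesgue_Measure.integrable_restrict_UNIV) auto
    moreover have "(\<lambda>x. if x \<in> {0<..<pi} then w x * indicator {\<alpha><..<\<beta>} x else 0) =
        (\<lambda>x. if x \<in> {\<alpha><..<\<beta>} then w x else 0)"
      using sub by (auto simp: indicator_def fun_eq_iff)
    ultimately show "integrable (lebesgue_on {\<alpha><..<\<beta>}) w"
      by (metis Lebesgue_Measure.integrable_restrict_UNIV lmeasurable_iff_integrable fmeasurableD lmeasurable_box box_real(1))
  qed auto
  finally show ?thesis using z by (simp add: integral_open_interval_real)
qed

text \<open>The means of \<open>w\<close> over short intervals to the right of a point all vanish,
  and by Lebesgue's differentiation theorem they converge to \<open>w\<close> at almost every
  point.\<close>

lemma test_orthogonal_AE_zero:
  fixes w :: "real \<Rightarrow> real"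
  assumes w: "integrable interval_measure_0_pi w"
    and 0: "\<And>\<psi>. \<psi> \<in> test_functions \<Longrightarrow> (LINT x|interval_measure_0_pi. w x * \<psi> x) = 0"
  shows "AE x in interval_measure_0_pi. w x = 0"
proof -
  define f where "f x = (if x \<in> {0<..<pi} then w x else 0)" for x
  have "integrable lebesgue f"
    unfolding f_def using w by (subst Lebesgue_Measure.integrable_restrict_UNIV) auto
  then have "f integrable_on UNIV" by (rule integrable_on_lebesgue)
  then have "f integrable_on cbox a b" for a b by (rule integrable_on_subcbox) simp
  then obtain N where N: "negligible N"
    "\<And>x e. x \<notin> N \<Longrightarrow> 0 < e \<Longrightarrow> \<exists>d>0. \<forall>h. 0 < h \<and> h < d \<longrightarrow>
        norm (integral (cbox x (x + h *\<^sub>R One)) f /\<^sub>R h ^ DIM(real) - f x) < e"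
    using integrable_ccontinuous_explicit by metis
  have "w x = 0" if x: "x \<in> {0<..<pi}" "x \<notin> N" for x
  proof (rule ccontr)
    assume "w x \<noteq> 0"
    then obtain d where d: "d > 0" "\<And>h. 0 < h \<Longrightarrow> h < d \<Longrightarrow>
        norm (integral (cbox x (x + h *\<^sub>R One)) f /\<^sub>R h ^ DIM(real) - f x) < \<bar>w x\<bar>"
      using N(2)[OF x(2), of "\<bar>w x\<bar>"] by auto
    define h where "h = min d (pi - x) / 2"
    have h: "0 < h" "h < d" "x + h < pi" using d x by (auto simp: h_def min_def field_simps)
    have "integral {x..x+h} f = integral {x..x+h} w"
      by (rule integral_cong) (use x h in \<open>auto simp: f_def\<close>)
    also have "\<dots> = 0" by (rule integral_subinterval_zero[OF w 0]) (use x h in auto)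
    finally show False using d(2)[of h] h x by (simp add: f_def)
  qed
  then have "AE x in lebesgue. x \<in> {0<..<pi} \<longrightarrow> w x = 0"
    using N(1) by (intro AE_I'[where N=N]) (auto simp: negligible_iff_null_sets)
  then show ?thesis by (subst AE_restrict_space_iff) auto
qed

text \<open>Any test function becomes the derivative of a test function once a multiple of the unit
  mass \<rho> is subtracted to give it zero mean; the value of \<open>w\<close> tested against
  \<rho> is the constant.\<close>

lemma du_Bois_Reymond:
  assumes w: "integrable interval_measure_0_pi w"
    and 0: "\<And>\<phi>. \<phi> \<in> test_functions \<Longrightarrow> (LINT x|interval_measure_0_pi. w x * deriv \<phi> x) = 0"
  obtains c where "AE x in interval_measure_0_pi. w x = c"
proof -
  obtain \<rho> where \<rho>: "\<rho> \<in> test_functions" "integral {0..pi} \<rho> = 1" using test_unit_mass by blast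
  define c where "c = (LINT x|interval_measure_0_pi. w x * \<rho> x)"
  have "AE x in interval_measure_0_pi. w x - c = 0"
  proof (rule test_orthogonal_AE_zero)
    show "integrable interval_measure_0_pi (\<lambda>x. w x - c)"
      by (intro Bochner_Integration.integrable_diff finite_measure.integrable_const[OF finite_interval_measure] w)
    fix \<psi> assume \<psi>: "\<psi> \<in> test_functions"
    define m where "m = integral {0..pi} \<psi>"
    have "integral {0..pi} (\<lambda>x. \<psi> x - m * \<rho> x) = m - m * 1"
      unfolding m_def
      by (subst integral_diff)
         (use test_continuous[OF \<psi>] test_continuous[OF \<rho>(1)] in \<open>auto intro!: integrable_continuous_real continuous_on_mult continuous_on_const simp: \<rho>(2)\<close>)
    then obtain \<phi> where \<phi>: "\<phi> \<in> test_functions" "deriv \<phi> = (\<lambda>x. \<psi> x - m * \<rho> x)"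
      using test_antiderivative[OF test_diff_cmult[OF \<psi> \<rho>(1), of m]] by auto
    have i: "integrable interval_measure_0_pi (\<lambda>x. w x * \<psi> x)" "integrable interval_measure_0_pi (\<lambda>x. w x * \<rho> x)"
       "integrable interval_measure_0_pi \<psi>"
      using integrable_times_test[OF w] \<psi> \<rho>(1) by (auto intro!: integrable_continuous_interval test_continuous)
    have "(LINT x|interval_measure_0_pi. (w x * \<psi> x - m * (w x * \<rho> x))) = 0"
      using 0[OF \<phi>(1)] by (simp add: \<phi>(2) algebra_simps)
    then have "(LINT x|interval_measure_0_pi. w x * \<psi> x) = m * c" using i by (simp add: c_def)
    moreover have "(LINT x|interval_measure_0_pi. \<psi> x) = m"
      unfolding m_def by (rule LINT_continuous_interval[OF test_continuous[OF \<psi>]])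
    ultimately show "(LINT x|interval_measure_0_pi. (w x - c) * \<psi> x) = 0"
      using i by (simp add: left_diff_distrib)
  qed
  then show ?thesis using that[of c] by simp
qed

lemma classical_imp_weak_deriv:
  assumes u: "\<And>x. x \<in> {0..pi} \<Longrightarrow> (u has_real_derivative v x) (at x within {0..pi})"
    and v: "continuous_on {0..pi} v"
  shows "has_weak_deriv u v"
proof -
  have cu: "continuous_on {0..pi} u" by (rule DERIV_continuous_on[OF u])
  have "(LINT x|interval_measure_0_pi. u x * deriv \<phi> x) = - (LINT x|interval_measure_0_pi. v x * \<phi> x)"
    if \<phi>: "\<phi> \<in> test_functions" for \<phi>
  proof -
    have c: "continuous_on {0..pi} \<phi>" "continuous_on {0..pi} (deriv \<phi>)"
      by (intro test_continuous test_deriv \<phi>)+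
    have ends: "\<phi> 0 = 0" "\<phi> pi = 0" using \<phi> by (auto elim!: test_functionsE)
    have "((\<lambda>x. u x * deriv \<phi> x + v x * \<phi> x) has_integral (u pi * \<phi> pi - u 0 * \<phi> 0)) {0..pi}"
      by (intro fundamental_theorem_of_calculus)
         (auto simp: has_real_derivative_iff_has_vector_derivative[symmetric]
           intro!: DERIV_mult' u has_field_derivative_at_within[OF test_DERIV[OF \<phi>]])
    then have "integral {0..pi} (\<lambda>x. u x * deriv \<phi> x + v x * \<phi> x) = 0" by (simp add: ends integral_unique)
    moreover have "integral {0..pi} (\<lambda>x. u x * deriv \<phi> x + v x * \<phi> x) =
       integral {0..pi} (\<lambda>x. u x * deriv \<phi> x) + integral {0..pi} (\<lambda>x. v x * \<phi> x)"
      by (intro integral_add integrable_continuous_real continuous_intros cu v c)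
    ultimately show ?thesis
      using LINT_continuous_interval[of "\<lambda>x. u x * deriv \<phi> x"] LINT_continuous_interval[of "\<lambda>x. v x * \<phi> x"] cu v c
      by (simp add: continuous_on_mult)
  qed
  then show ?thesis using L2_continuous cu v by (simp add: has_weak_deriv_def)
qed

text \<open>\<open>w\<close> minus the primitive of \<open>h\<close> has weak derivative 0, hence is
  constant. Since weak derivatives carry no pointwise information, continuity is asked of an almost
  everywhere equal \<open>h\<close>; so the result can be applied twice in a row, its output
  \<open>W\<close> serving as the next \<open>h\<close>.\<close>

lemma weak_deriv_continuous_imp_classical:
  assumes w: "has_weak_deriv w g" and g: "AE x in interval_measure_0_pi. g x = h x"
    and h: "continuous_on {0..pi} h"
  obtains W where "\<And>x. x \<in> {0..pi} \<Longrightarrow> (W has_real_derivative h x) (at x within {0..pi})"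
    "AE x in interval_measure_0_pi. w x = W x"
proof -
  define V where "V x = integral {0..x} h" for x
  have V: "(V has_real_derivative h x) (at x within {0..pi})" if "x \<in> {0..pi}" for x
    unfolding V_def using integral_has_real_derivative[OF h that] .
  have wV: "has_weak_deriv V h" by (rule classical_imp_weak_deriv[OF V h])
  have iw: "integrable interval_measure_0_pi w" "integrable interval_measure_0_pi V"
    using w wV L2_integrable by (auto simp: has_weak_deriv_def)
  obtain c where c: "AE x in interval_measure_0_pi. w x - V x = c"
  proof (rule du_Bois_Reymond[of "\<lambda>x. w x - V x"])
    show "integrable interval_measure_0_pi (\<lambda>x. w x - V x)" using iw by auto
    fix \<phi> assume \<phi>: "\<phi> \<in> test_functions"
    have "(LINT x|interval_measure_0_pi. (w x - V x) * deriv \<phi> x) =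
      (LINT x|interval_measure_0_pi. w x * deriv \<phi> x) - (LINT x|interval_measure_0_pi. V x * deriv \<phi> x)"
      using integrable_times_test[OF _ test_deriv[OF \<phi>]] iw by (simp add: left_diff_distrib)
    also have "\<dots> = - (LINT x|interval_measure_0_pi. g x * \<phi> x) + (LINT x|interval_measure_0_pi. h x * \<phi> x)"
      using w wV \<phi> by (simp add: has_weak_deriv_def)
    also have "(LINT x|interval_measure_0_pi. g x * \<phi> x) = (LINT x|interval_measure_0_pi. h x * \<phi> x)"
    proof (rule integral_cong_AE)
      have mg: "g \<in> borel_measurable interval_measure_0_pi" using w by (simp add: has_weak_deriv_def L2_def)
      show "(\<lambda>x. g x * \<phi> x) \<in> borel_measurable interval_measure_0_pi"
        by (intro borel_measurable_times mg measurable_continuous_interval[OF test_continuous[OF \<phi>]])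
      show "(\<lambda>x. h x * \<phi> x) \<in> borel_measurable interval_measure_0_pi"
        by (intro borel_measurable_times measurable_continuous_interval test_continuous \<phi> h)
      show "AE x in interval_measure_0_pi. g x * \<phi> x = h x * \<phi> x" using g by eventually_elim simp
    qed
    finally show "(LINT x|interval_measure_0_pi. (w x - V x) * deriv \<phi> x) = 0" by simp
  qed
  show ?thesis
  proof (rule that[of "\<lambda>x. V x + c"])
    show "AE x in interval_measure_0_pi. w x = V x + c" using c by eventually_elim simp
  qed (auto intro!: derivative_eq_intros V)
qed

lemma AE_zero_continuous:
  fixes f :: "real \<Rightarrow> real"
  assumes "AE x in interval_measure_0_pi. f x = 0" "continuous_on {0..pi} f" "x \<in> {0..pi}"
  shows "f x = 0"
proof -
  have op: "f y = 0" if y: "y \<in> {0<..<pi}" for y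
  proof (rule ccontr)
    assume "f y \<noteq> 0"
    define U where "U = {0<..<pi} \<inter> f -` (- {0})"
    have "open U" unfolding U_def
      by (intro continuous_open_preimage continuous_on_subset[OF assms(2)]) auto
    moreover have "y \<in> U" using y \<open>f y \<noteq> 0\<close> by (simp add: U_def)
    ultimately have "\<not> negligible U" using open_not_negligible by blast
    have "AE x in lebesgue. x \<in> {0<..<pi} \<longrightarrow> f x = 0"
      using assms(1) by (subst (asm) AE_restrict_space_iff) auto
    then have "AE x in lebesgue. x \<notin> U" by eventually_elim (auto simp: U_def)
    moreover have "U \<in> sets lebesgue" using \<open>open U\<close> by auto
    ultimately have "U \<in> null_sets lebesgue" by (simp add: AE_iff_null_sets)
    then show False using \<open>\<not> negligible U\<close> by (simp add: negligible_iff_null_sets)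
  qed
  have "x \<in> closure {0<..<pi}" using assms(3) by simp
  then show ?thesis
    using continuous_constant_on_closure[of "{0<..<pi}" f 0 x] assms(2) op by simp
qed

section \<open>Approximation by test functions in the H1 norm\<close>

lemma abs_le_integral_abs_deriv:
  fixes h h' :: "real \<Rightarrow> real"
  assumes h: "\<And>x. x \<in> {0..pi} \<Longrightarrow> (h has_real_derivative h' x) (at x within {0..pi})"
    and c: "continuous_on {0..pi} h'" and "h 0 = 0" and x: "x \<in> {0..pi}"
  shows "\<bar>h x\<bar> \<le> integral {0..pi} (\<lambda>x. \<bar>h' x\<bar>)"
proof -
  have cx: "continuous_on {0..x} h'" using x by (intro continuous_on_subset[OF c]) auto
  have "(h' has_integral h x - h 0) {0..x}"
    using x by (intro fundamental_theorem_of_calculus)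
      (auto simp: has_real_derivative_iff_has_vector_derivative[symmetric] intro!: DERIV_subset[OF h])
  then have "h x = integral {0..x} h'" using assms by (simp add: integral_unique)
  also have "\<bar>\<dots>\<bar> \<le> integral {0..x} (\<lambda>x. \<bar>h' x\<bar>)"
    using integral_norm_bound_integral[of h' "{0..x}" "\<lambda>x. \<bar>h' x\<bar>"] cx
    by (simp add: integrable_continuous_real continuous_on_rabs)
  also have "\<dots> \<le> integral {0..pi} (\<lambda>x. \<bar>h' x\<bar>)"
    using x c cx by (intro integral_subset_le integrable_continuous_real continuous_on_rabs) auto
  finally show ?thesis .
qed

text \<open>Polynomials close to \<open>v\<close>, cut off by plateaus, are test functions but may
  have nonzero mean; subtracting the mean times a fixed \<rho> makes them derivatives of test
  functions. The bound \<open>B\<close>, uniform in \<open>n\<close>, is the majorant for dominated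
  convergence.\<close>

lemma test_bounded_approximation:
  fixes v :: "real \<Rightarrow> real"
  assumes v: "continuous_on {0..pi} v" and v0: "integral {0..pi} v = 0"
  obtains \<phi> B where "\<And>n. \<phi> n \<in> test_functions"
    "\<And>x. x \<in> {0<..<pi} \<Longrightarrow> (\<lambda>n. deriv (\<phi> n) x) \<longlonglongrightarrow> v x"
    "\<And>n x. x \<in> {0..pi} \<Longrightarrow> \<bar>v x - deriv (\<phi> n) x\<bar> \<le> B"
proof -
  have "compact (v ` {0..pi})" by (intro compact_continuous_image v) auto
  then obtain C where C: "\<And>x. x \<in> {0..pi} \<Longrightarrow> \<bar>v x\<bar> \<le> C"
    using compact_imp_bounded[of "v ` {0..pi}"] by (auto simp: bounded_iff simp del: atLeastAtMost_iff)
  have "\<exists>p. smooth p \<and> (\<forall>x\<in>{0..pi}. \<bar>v x - p x\<bar> < 1 / real (Suc n))" for n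
    using Stone_Weierstrass_real_polynomial_function[OF compact_Icc v, of "1 / real (Suc n)"]
      smooth_real_polynomial by (metis of_nat_0_less_iff zero_less_Suc zero_less_divide_1_iff)
  then obtain p where p: "\<And>n. smooth (p n)" "\<And>n x. x \<in> {0..pi} \<Longrightarrow> \<bar>v x - p n x\<bar> < 1 / real (Suc n)"
    by metis
  obtain \<eta> where \<eta>: "\<And>n. \<eta> n \<in> test_functions" "\<And>n x. \<bar>\<eta> n x\<bar> \<le> 1"
    "\<And>x. (\<lambda>n. \<eta> n x) \<longlonglongrightarrow> indicator {0<..<pi} x"
    using test_plateaus[of 0 pi] pi_gt_zero by (metis order_refl)
  obtain \<rho> where \<rho>: "\<rho> \<in> test_functions" "integral {0..pi} \<rho> = 1" using test_unit_mass by blast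
  obtain R where R: "\<And>x. \<bar>\<rho> x\<bar> \<le> R" using test_bounded[OF \<rho>(1)] by blast
  define \<psi> where "\<psi> n x = \<eta> n x * p n x" for n x
  define m where "m n = integral {0..pi} (\<psi> n)" for n
  have \<psi>: "\<psi> n \<in> test_functions" for n
    unfolding \<psi>_def by (rule test_smooth_mult[OF \<eta>(1) p(1)])
  have pv: "(\<lambda>n. p n x) \<longlonglongrightarrow> v x" if "x \<in> {0..pi}" for x
  proof -
    have "(\<lambda>n. p n x - v x) \<longlonglongrightarrow> 0"
      by (rule tendsto_rabs_zero_cancel, rule tendsto_sandwich[OF _ _ tendsto_const LIMSEQ_Suc[OF lim_1_over_n]])
         (use p(2)[OF that] in \<open>auto intro!: always_eventually less_imp_le simp: abs_minus_commute\<close>)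
    then show ?thesis by (simp add: LIM_zero_iff)
  qed
  have \<psi>v: "(\<lambda>n. \<psi> n x) \<longlonglongrightarrow> v x" if "x \<in> {0<..<pi}" for x
    using tendsto_mult[OF \<eta>(3)[of x] pv[of x]] that by (simp add: \<psi>_def)
  have pb: "\<bar>\<psi> n x\<bar> \<le> C + 1" if x: "x \<in> {0..pi}" for n x
  proof -
    have "1 / real (Suc n) \<le> 1" by simp
    then have "\<bar>p n x\<bar> \<le> C + 1" using C[OF x] p(2)[OF x, of n] by linarith
    then have "\<bar>\<eta> n x\<bar> * \<bar>p n x\<bar> \<le> 1 * (C + 1)" by (intro mult_mono \<eta>) auto
    then show ?thesis by (simp add: \<psi>_def abs_mult)
  qed
  have "(\<lambda>n. LINT x|interval_measure_0_pi. \<psi> n x) \<longlonglongrightarrow> (LINT x|interval_measure_0_pi. v x)"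
  proof (rule integral_dominated_convergence[where w="\<lambda>x. C + 1"])
    show "v \<in> borel_measurable interval_measure_0_pi" by (rule measurable_continuous_interval[OF v])
    show "\<psi> n \<in> borel_measurable interval_measure_0_pi" for n
      by (rule measurable_continuous_interval[OF test_continuous[OF \<psi>]])
    show "integrable interval_measure_0_pi (\<lambda>x. C + 1)"
      by (rule finite_measure.integrable_const[OF finite_interval_measure])
    show "AE x in interval_measure_0_pi. (\<lambda>n. \<psi> n x) \<longlonglongrightarrow> v x"
      by (rule AE_I2) (use \<psi>v in \<open>simp add: space_restrict_space\<close>)
    show "AE x in interval_measure_0_pi. norm (\<psi> n x) \<le> C + 1" for n
      by (rule AE_I2) (use pb in \<open>simp add: space_restrict_space\<close>)
  qed
  \<comment> \<open>The means tend to that of \<open>v\<close>, which is 0, so the corrections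
    disappear in the limit.\<close>
  then have m0: "m \<longlonglongrightarrow> 0"
    using LINT_continuous_interval[OF v] LINT_continuous_interval[OF test_continuous[OF \<psi>]] by (simp add: m_def[abs_def] v0)
  obtain K where K: "\<And>n. \<bar>m n\<bar> \<le> K"
    using convergent_imp_Bseq[OF convergentI[OF m0]] by (auto simp: Bseq_def)
  have "\<exists>\<phi>. \<phi> \<in> test_functions \<and> deriv \<phi> = (\<lambda>x. \<psi> n x - m n * \<rho> x)" for n
  proof -
    have "integral {0..pi} (\<lambda>x. \<psi> n x - m n * \<rho> x) = m n - m n * 1"
      unfolding m_def
      by (subst integral_diff)
         (use test_continuous[OF \<psi>] test_continuous[OF \<rho>(1)] in \<open>auto intro!: integrable_continuous_real continuous_on_mult continuous_on_const simp: \<rho>(2)\<close>)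
    then have "integral {0..pi} (\<lambda>x. \<psi> n x - m n * \<rho> x) = 0" by simp
    from test_antiderivative[OF test_diff_cmult[OF \<psi> \<rho>(1)] this] show ?thesis by metis
  qed
  then obtain \<phi> where \<phi>: "\<And>n. \<phi> n \<in> test_functions" "\<And>n. deriv (\<phi> n) = (\<lambda>x. \<psi> n x - m n * \<rho> x)"
    by metis
  show ?thesis
  proof (rule that[of \<phi>])
    fix x assume "x \<in> {0<..<pi}"
    then have "(\<lambda>n. \<psi> n x - m n * \<rho> x) \<longlonglongrightarrow> v x - 0 * \<rho> x"
      by (intro tendsto_diff tendsto_mult \<psi>v m0 tendsto_const)
    then show "(\<lambda>n. deriv (\<phi> n) x) \<longlonglongrightarrow> v x" by (simp add: \<phi>)
  next
    fix n x assume x: "x \<in> {0..pi}"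
    have "\<bar>m n * \<rho> x\<bar> \<le> K * R"
      unfolding abs_mult using K[of n] R[of x] by (intro mult_mono) auto
    then show "\<bar>v x - deriv (\<phi> n) x\<bar> \<le> C + (C + 1) + K * R"
      using C[OF x] pb[OF x, of n] by (simp add: \<phi>)
  qed (rule \<phi>(1))
qed

text \<open>Approximating the derivative suffices: \<open>u\<close> and the test functions vanish at
  0, so their distance is at most the integral of the absolute difference of the derivatives. Equal
  values of \<open>u\<close> at both ends give \<open>v\<close> the required zero mean.\<close>

lemma classical_imp_H10:
  assumes u: "\<And>x. x \<in> {0..pi} \<Longrightarrow> (u has_real_derivative v x) (at x within {0..pi})"
    and v: "continuous_on {0..pi} v" and ends: "u 0 = 0" "u pi = 0"
  shows "u \<in> H10"
proof -
  have cu: "continuous_on {0..pi} u" by (rule DERIV_continuous_on[OF u])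
  have "(v has_integral u pi - u 0) {0..pi}"
    by (intro fundamental_theorem_of_calculus)
       (auto simp: has_real_derivative_iff_has_vector_derivative[symmetric] u)
  then have "integral {0..pi} v = 0" by (simp add: ends integral_unique)
  then obtain \<phi> B where \<phi>: "\<And>n. \<phi> n \<in> test_functions"
    "\<And>x. x \<in> {0<..<pi} \<Longrightarrow> (\<lambda>n. deriv (\<phi> n) x) \<longlonglongrightarrow> v x"
    "\<And>n x. x \<in> {0..pi} \<Longrightarrow> \<bar>v x - deriv (\<phi> n) x\<bar> \<le> B"
    using test_bounded_approximation[OF v] by metis
  have cd: "continuous_on {0..pi} (\<lambda>x. v x - deriv (\<phi> n) x)" for n
    by (intro continuous_on_diff v test_continuous test_deriv \<phi>)
  \<comment> \<open>Used with \<open>k = 1\<close> for the uniform bound on the functions and with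
    \<open>k = 2\<close> for the derivative term of the norm.\<close>
  have lim: "(\<lambda>n. LINT x|interval_measure_0_pi. \<bar>v x - deriv (\<phi> n) x\<bar> ^ k) \<longlonglongrightarrow> (LINT x|interval_measure_0_pi. 0)"
    if k: "k > 0" for k
  proof (rule integral_dominated_convergence[where w="\<lambda>x. B ^ k"])
    show "(\<lambda>x. \<bar>v x - deriv (\<phi> n) x\<bar> ^ k) \<in> borel_measurable interval_measure_0_pi" for n
      by (intro measurable_continuous_interval continuous_on_power continuous_on_rabs cd)
    show "integrable interval_measure_0_pi (\<lambda>x. B ^ k)"
      by (rule finite_measure.integrable_const[OF finite_interval_measure])
    show "AE x in interval_measure_0_pi. (\<lambda>n. \<bar>v x - deriv (\<phi> n) x\<bar> ^ k) \<longlonglongrightarrow> 0"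
    proof (rule AE_I2)
      fix x assume "x \<in> space interval_measure_0_pi"
      then have "(\<lambda>n. \<bar>v x - deriv (\<phi> n) x\<bar> ^ k) \<longlonglongrightarrow> \<bar>v x - v x\<bar> ^ k"
        by (intro tendsto_intros \<phi>(2)) (simp add: space_restrict_space)
      then show "(\<lambda>n. \<bar>v x - deriv (\<phi> n) x\<bar> ^ k) \<longlonglongrightarrow> 0" using k by (simp add: power_0_left)
    qed
    show "AE x in interval_measure_0_pi. norm (\<bar>v x - deriv (\<phi> n) x\<bar> ^ k) \<le> B ^ k" for n
      by (rule AE_I2) (auto simp: space_restrict_space intro!: power_mono \<phi>(3))
  qed simp
  define \<delta> where "\<delta> n = integral {0..pi} (\<lambda>x. \<bar>v x - deriv (\<phi> n) x\<bar>)" for n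
  have \<delta>: "\<delta> \<longlonglongrightarrow> 0"
    using lim[of 1] LINT_continuous_interval[OF continuous_on_rabs[OF cd]] by (simp add: \<delta>_def[abs_def])
  have bound: "(LINT x|interval_measure_0_pi. (u x - \<phi> n x)\<^sup>2) \<le> (\<delta> n)\<^sup>2 * pi" for n
  proof -
    have "\<phi> n 0 = 0" using \<phi>(1)[of n] by (auto elim!: test_functionsE)
    then have "\<bar>u x - \<phi> n x\<bar> \<le> \<delta> n" if "x \<in> {0..pi}" for x
      unfolding \<delta>_def
      by (intro abs_le_integral_abs_deriv[OF _ cd _ that])
         (auto intro!: DERIV_diff u has_field_derivative_at_within[OF test_DERIV[OF \<phi>(1)]] simp: ends)
    then have "(u x - \<phi> n x)\<^sup>2 \<le> (\<delta> n)\<^sup>2" if "x \<in> {0..pi}" for x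
      using that by (metis abs_le_square_iff abs_of_nonneg abs_ge_zero order_trans)
    then have "integral {0..pi} (\<lambda>x. (u x - \<phi> n x)\<^sup>2) \<le> integral {0..pi} (\<lambda>x. (\<delta> n)\<^sup>2)"
      by (intro integral_le integrable_continuous_real continuous_intros cu test_continuous[OF \<phi>(1)]) auto
    moreover have "continuous_on {0..pi} (\<lambda>x. (u x - \<phi> n x)\<^sup>2)"
      by (intro continuous_intros cu test_continuous[OF \<phi>(1)])
    ultimately show ?thesis using LINT_continuous_interval[of "\<lambda>x. (u x - \<phi> n x)\<^sup>2"] by (simp add: mult.commute)
  qed
  have "(\<lambda>n. (\<delta> n)\<^sup>2 * pi + (LINT x|interval_measure_0_pi. (v x - deriv (\<phi> n) x)\<^sup>2)) \<longlonglongrightarrow> 0\<^sup>2 * pi + 0"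
    using lim[of 2] by (intro tendsto_intros \<delta>) simp
  then have "\<exists>\<phi>\<in>test_functions. (LINT x|interval_measure_0_pi. (u x - \<phi> x)\<^sup>2) +
        (LINT x|interval_measure_0_pi. (v x - deriv \<phi> x)\<^sup>2) < \<epsilon>" if "\<epsilon> > 0" for \<epsilon>
  proof -
    assume "(\<lambda>n. (\<delta> n)\<^sup>2 * pi + (LINT x|interval_measure_0_pi. (v x - deriv (\<phi> n) x)\<^sup>2)) \<longlonglongrightarrow> 0\<^sup>2 * pi + 0"
    then have "\<forall>\<^sub>F n in sequentially. (\<delta> n)\<^sup>2 * pi + (LINT x|interval_measure_0_pi. (v x - deriv (\<phi> n) x)\<^sup>2) < \<epsilon>"
      using that by (intro order_tendstoD(2)) auto
    then obtain n where "(\<delta> n)\<^sup>2 * pi + (LINT x|interval_measure_0_pi. (v x - deriv (\<phi> n) x)\<^sup>2) < \<epsilon>"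
      by (meson eventually_sequentially order_refl)
    then show ?thesis using bound[of n] \<phi>(1)[of n] by (intro bexI[of _ "\<phi> n"]) linarith+
  qed
  then show ?thesis
    using classical_imp_weak_deriv[OF u v] unfolding H10_def by blast
qed

text \<open>For a single \<open>u\<close> the nonlocal coefficient is just a positive number, so
  dividing by it expresses \<open>uxx\<close> through the continuous \<open>u\<close>; two
  integrations then upgrade \<open>ux\<close> and \<open>u\<close>.\<close>

lemma equilibria_iff_classical:
  assumes pos: "\<And>t. a t > 0"
  shows "u \<in> equilibria a b lam \<longleftrightarrow> (\<forall>x. x \<notin> {0..pi} \<longrightarrow> u x = 0) \<and> u 0 = 0 \<and> u pi = 0 \<and>
    (\<exists>v. classical_solution (a (integral {0..pi} (\<lambda>x. (v x)\<^sup>2))) b lam u v)"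
proof
  assume "u \<in> equilibria a b lam"
  then obtain ux uxx where cu: "continuous_on {0..pi} u" and out: "\<forall>x. x \<notin> {0..pi} \<longrightarrow> u x = 0" "u 0 = 0" "u pi = 0"
    and w: "has_weak_deriv u ux" "has_weak_deriv ux uxx"
    and eq: "AE x in interval_measure_0_pi. a (LINT y|interval_measure_0_pi. \<bar>ux y\<bar>\<^sup>2) * uxx x + lam * u x - b * (u x) ^ 3 = 0"
    unfolding equilibria_def by blast
  define A where "A = a (LINT y|interval_measure_0_pi. \<bar>ux y\<bar>\<^sup>2)"
  have A: "A > 0" using pos by (simp add: A_def)
  define h where "h x = - (lam * u x - b * u x ^ 3) / A" for x
  have ch: "continuous_on {0..pi} h" unfolding h_def using A by (intro continuous_intros cu) auto
  have "AE x in interval_measure_0_pi. uxx x = h x"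
    using eq unfolding A_def[symmetric] by eventually_elim (use A in \<open>simp add: h_def field_simps\<close>)
  then obtain W where W: "\<And>x. x \<in> {0..pi} \<Longrightarrow> (W has_real_derivative h x) (at x within {0..pi})"
    "AE x in interval_measure_0_pi. ux x = W x"
    using weak_deriv_continuous_imp_classical[OF w(2) _ ch] by metis
  have cW: "continuous_on {0..pi} W" by (rule DERIV_continuous_on[OF W(1)])
  obtain U where U: "\<And>x. x \<in> {0..pi} \<Longrightarrow> (U has_real_derivative W x) (at x within {0..pi})"
    "AE x in interval_measure_0_pi. u x = U x"
    using weak_deriv_continuous_imp_classical[OF w(1) W(2) cW] by metis
  have cU: "continuous_on {0..pi} U" by (rule DERIV_continuous_on[OF U(1)])
  \<comment> \<open>Both functions are continuous and agree almost everywhere; here the choice of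
    the continuous representative matters.\<close>
  have uU: "u x = U x" if "x \<in> {0..pi}" for x
  proof -
    have "AE x in interval_measure_0_pi. u x - U x = 0" using U(2) by eventually_elim simp
    from AE_zero_continuous[OF this continuous_on_diff[OF cu cU] that] show ?thesis by simp
  qed
  have "(LINT y|interval_measure_0_pi. \<bar>ux y\<bar>\<^sup>2) = (LINT y|interval_measure_0_pi. (W y)\<^sup>2)"
  proof (rule integral_cong_AE)
    have "ux \<in> borel_measurable interval_measure_0_pi" using w by (simp add: has_weak_deriv_def L2_def)
    then show "(\<lambda>x. \<bar>ux x\<bar>\<^sup>2) \<in> borel_measurable interval_measure_0_pi" by measurable
    show "(\<lambda>x. (W x)\<^sup>2) \<in> borel_measurable interval_measure_0_pi"
      by (intro measurable_continuous_interval continuous_intros cW)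
    show "AE x in interval_measure_0_pi. \<bar>ux x\<bar>\<^sup>2 = (W x)\<^sup>2" using W(2) by eventually_elim simp
  qed
  also have "\<dots> = integral {0..pi} (\<lambda>x. (W x)\<^sup>2)"
    by (intro LINT_continuous_interval continuous_intros cW)
  finally have AW: "a (integral {0..pi} (\<lambda>x. (W x)\<^sup>2)) = A" by (simp add: A_def)
  have "(u has_real_derivative W x) (at x within {0..pi})" if "x \<in> {0..pi}" for x
    by (rule has_field_derivative_transform_within[OF U(1)[OF that] zero_less_one that]) (use uU in auto)
  then have "classical_solution A b lam u W"
    using W(1) by (auto simp: classical_solution_def h_def)
  then show "(\<forall>x. x \<notin> {0..pi} \<longrightarrow> u x = 0) \<and> u 0 = 0 \<and> u pi = 0 \<and>
    (\<exists>v. classical_solution (a (integral {0..pi} (\<lambda>x. (v x)\<^sup>2))) b lam u v)"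
    using out AW by metis
next
  assume "(\<forall>x. x \<notin> {0..pi} \<longrightarrow> u x = 0) \<and> u 0 = 0 \<and> u pi = 0 \<and>
    (\<exists>v. classical_solution (a (integral {0..pi} (\<lambda>x. (v x)\<^sup>2))) b lam u v)"
  then obtain v where out: "\<forall>x. x \<notin> {0..pi} \<longrightarrow> u x = 0" "u 0 = 0" "u pi = 0"
    and sol: "classical_solution (a (integral {0..pi} (\<lambda>x. (v x)\<^sup>2))) b lam u v" by blast
  define A where "A = a (integral {0..pi} (\<lambda>x. (v x)\<^sup>2))"
  have A: "A > 0" using pos by (simp add: A_def)
  have du: "\<And>x. x \<in> {0..pi} \<Longrightarrow> (u has_real_derivative v x) (at x within {0..pi})"
    and dv: "\<And>x. x \<in> {0..pi} \<Longrightarrow> (v has_real_derivative - (lam * u x - b * u x ^ 3) / A) (at x within {0..pi})"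
    using sol by (auto simp: classical_solution_def A_def)
  have c: "continuous_on {0..pi} u" "continuous_on {0..pi} v"
    by (rule DERIV_continuous_on[OF du], assumption) (rule DERIV_continuous_on[OF dv])
  have w: "has_weak_deriv u v" by (rule classical_imp_weak_deriv[OF du c(2)])
  have w': "has_weak_deriv v (\<lambda>x. - (lam * u x - b * u x ^ 3) / A)"
    by (rule classical_imp_weak_deriv[OF dv]) (use A in \<open>auto intro!: continuous_intros c\<close>)
  have "(LINT y|interval_measure_0_pi. \<bar>v y\<bar>\<^sup>2) = integral {0..pi} (\<lambda>x. (v x)\<^sup>2)"
    using LINT_continuous_interval[of "\<lambda>x. (v x)\<^sup>2"] c by (simp add: continuous_on_power)
  then have "AE x in interval_measure_0_pi. a (LINT y|interval_measure_0_pi. \<bar>v y\<bar>\<^sup>2) * (- (lam * u x - b * u x ^ 3) / A) + lam * u x - b * (u x) ^ 3 = 0"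
    using A by (simp add: A_def[symmetric])
  then show "u \<in> equilibria a b lam"
    unfolding equilibria_def H2_def using out c w w' classical_imp_H10[OF du c(2) out(2,3)] by blast
qed

section \<open>The equilibria\<close>

lemma classical_solution_cong:
  assumes sol: "classical_solution A b lam u v" and eq: "\<And>x. x \<in> {0..pi} \<Longrightarrow> w x = u x"
  shows "classical_solution A b lam w v"
  unfolding classical_solution_def
proof (intro ballI conjI)
  fix x assume x: "x \<in> {0..pi}"
  have d: "(u has_real_derivative v x) (at x within {0..pi})"
    "(v has_real_derivative - (lam * u x - b * u x ^ 3) / A) (at x within {0..pi})"
    using sol x by (auto simp: classical_solution_def)
  show "(w has_real_derivative v x) (at x within {0..pi})"
    by (rule has_field_derivative_transform_within[OF d(1) zero_less_one x]) (use eq in auto)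
  show "(v has_real_derivative - (lam * w x - b * w x ^ 3) / A) (at x within {0..pi})"
    using d(2) eq[OF x] by simp
qed

context cubic_nonlinearity
begin

text \<open>Truncated because the counted representatives vanish outside the closed interval,
  whereas a profile goes on oscillating.\<close>

definition branch :: "real \<Rightarrow> (real \<Rightarrow> real) \<Rightarrow> real \<Rightarrow> real" where
  "branch \<mu> \<theta> x = (if x \<in> {0..pi} then profile \<mu> \<theta> x else 0)"

lemma balanced_length:
  assumes pos: "\<And>t. a t > 0" and bal: "balanced a j \<mu>" and j: "j \<ge> 1"
  shows "diffusivity j \<mu> > 0" "real j * (sqrt (diffusivity j \<mu>) * half_period \<mu>) = pi"
proof -
  have I: "half_period \<mu> > 0" using bal half_period_pos by (simp add: balanced_def)
  show "diffusivity j \<mu> > 0" using bal pos by (simp add: balanced_def)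
  show "real j * (sqrt (diffusivity j \<mu>) * half_period \<mu>) = pi"
    using I j by (simp add: diffusivity_def)
qed

lemma branch_equilibrium:
  assumes pos: "\<And>t. a t > 0" and bal: "balanced a j \<mu>" and j: "j \<ge> 1"
    and \<theta>: "is_phase (diffusivity j \<mu>) \<mu> \<theta>"
  shows "branch \<mu> \<theta> \<in> equilibria a b lam" "(\<lambda>x. - branch \<mu> \<theta> x) \<in> equilibria a b lam"
    and "card {x \<in> {0..pi}. branch \<mu> \<theta> x = 0} = j + 1"
proof -
  define A where "A = diffusivity j \<mu>"
  have A: "A > 0" "real j * (sqrt A * half_period \<mu>) = pi"
    using balanced_length[of a, OF pos bal j] by (simp_all add: A_def)
  have \<mu>: "0 < \<mu>" "\<mu> < lam / 2" "a (dirichlet j \<mu>) = A" using bal by (auto simp: balanced_def A_def)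
  have \<theta>A: "is_phase A \<mu> \<theta>" using \<theta> by (simp add: A_def)
  have card: "card {x \<in> {0..pi}. profile \<mu> \<theta> x = 0} = j + 1"
    by (rule card_profile_zeros[OF A(1) \<mu>(1,2) \<theta>A A(2)])
  have "{x \<in> {0..pi}. branch \<mu> \<theta> x = 0} = {x \<in> {0..pi}. profile \<mu> \<theta> x = 0}" by (auto simp: branch_def)
  then show "card {x \<in> {0..pi}. branch \<mu> \<theta> x = 0} = j + 1" using card by simp
  have sol: "classical_solution A b lam (branch \<mu> \<theta>) (profile_slope A \<mu> \<theta>)"
    by (rule classical_solution_cong[OF profile_classical_solution[OF A(1) _ \<mu>(2) \<theta>A]]) (use \<mu> in \<open>auto simp: branch_def\<close>)
  have "profile \<mu> \<theta> 0 = 0" "profile \<mu> \<theta> pi = 0"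
    using profile_zero_iff[OF A(1) \<mu>(1,2) \<theta>A, of 0] profile_zero_iff[OF A(1) \<mu>(1,2) \<theta>A, of pi] A(2)
    by (auto intro: exI[of _ 0] exI[of _ j])
  then have ends: "branch \<mu> \<theta> 0 = 0" "branch \<mu> \<theta> pi = 0" by (auto simp: branch_def)
  have D: "a (integral {0..pi} (\<lambda>x. (profile_slope A \<mu> \<theta> x)\<^sup>2)) = A"
    using integral_profile_slope(1)[OF A(1) \<mu>(1,2) \<theta>A A(2)] \<mu>(3) by simp
  have out: "\<forall>x. x \<notin> {0..pi} \<longrightarrow> branch \<mu> \<theta> x = 0" by (simp add: branch_def)
  show "branch \<mu> \<theta> \<in> equilibria a b lam"
    using sol ends out D equilibria_iff_classical[of a, OF pos] by metis
  have D': "a (integral {0..pi} (\<lambda>x. (- profile_slope A \<mu> \<theta> x)\<^sup>2)) = A" using D by simp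
  show "(\<lambda>x. - branch \<mu> \<theta> x) \<in> equilibria a b lam"
    unfolding equilibria_iff_classical[of a, OF pos]
  proof (intro conjI exI[of _ "\<lambda>x. - profile_slope A \<mu> \<theta> x"])
    show "classical_solution (a (integral {0..pi} (\<lambda>x. (- profile_slope A \<mu> \<theta> x)\<^sup>2))) b lam
        (\<lambda>x. - branch \<mu> \<theta> x) (\<lambda>x. - profile_slope A \<mu> \<theta> x)"
      unfolding D' by (rule classical_solution_minus[OF sol])
  qed (use out ends in auto)
qed

lemma zero_equilibrium:
  assumes pos: "\<And>t. a t > 0" shows "(\<lambda>x. 0) \<in> equilibria a b lam"
  unfolding equilibria_iff_classical[of a, OF pos]
  using classical_solution_const[of lam 0 b] by auto

text \<open>The slope of the solution is that of a profile up to sign, so its Dirichlet energy is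
  \<open>dirichlet j \<mu>\<close>; the coefficient produced by this energy is also forced to be
  \<open>diffusivity j \<mu>\<close> by the arch length.\<close>

lemma equilibrium_cases:
  assumes pos: "\<And>t. a t > 0" and u: "u \<in> equilibria a b lam" and nz: "u \<noteq> (\<lambda>x. 0)"
  obtains j \<mu> where "j \<ge> 1" "balanced a j \<mu>"
    "\<And>\<theta>. is_phase (diffusivity j \<mu>) \<mu> \<theta> \<Longrightarrow> u = branch \<mu> \<theta> \<or> u = (\<lambda>x. - branch \<mu> \<theta> x)"
proof -
  obtain v where out: "\<forall>x. x \<notin> {0..pi} \<longrightarrow> u x = 0" and ends: "u 0 = 0" "u pi = 0"
    and sol: "classical_solution (a (integral {0..pi} (\<lambda>x. (v x)\<^sup>2))) b lam u v"
    using u unfolding equilibria_iff_classical[of a, OF pos] by blast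
  define A where "A = a (integral {0..pi} (\<lambda>x. (v x)\<^sup>2))"
  have A: "A > 0" using pos by (simp add: A_def)
  obtain x1 where "u x1 \<noteq> 0" using nz by auto
  then have x1: "x1 \<in> {0..pi}" "u x1 \<noteq> 0" using out by auto
  obtain \<mu> j s where \<mu>: "0 < \<mu>" "\<mu> < lam / 2" and j: "j \<ge> 1" "real j * (sqrt A * half_period \<mu>) = pi"
    and s: "s = 1 \<or> s = -1"
    and rep: "\<And>\<theta> x. is_phase A \<mu> \<theta> \<Longrightarrow> x \<in> {0..pi} \<Longrightarrow> u x = s * profile \<mu> \<theta> x \<and> v x = s * profile_slope A \<mu> \<theta> x"
    using classical_solution_cases[OF sol[folded A_def] A ends x1] by metis
  obtain \<theta> where \<theta>: "is_phase A \<mu> \<theta>" using phase_exists[OF A, of \<mu>] \<mu> by auto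
  have "integral {0..pi} (\<lambda>x. (v x)\<^sup>2) = integral {0..pi} (\<lambda>x. (profile_slope A \<mu> \<theta> x)\<^sup>2)"
    by (rule integral_cong) (use rep[OF \<theta>] s in auto)
  then have "A = a (dirichlet j \<mu>)" unfolding A_def[symmetric]
    using integral_profile_slope(1)[OF A \<mu> \<theta> j(2)] by (simp add: A_def)
  moreover have AD: "A = diffusivity j \<mu>" by (rule integral_profile_slope(2)[OF A \<mu> \<theta> j(2)])
  ultimately have "balanced a j \<mu>" using \<mu> by (simp add: balanced_def)
  moreover have "u = branch \<mu> \<theta> \<or> u = (\<lambda>x. - branch \<mu> \<theta> x)" if "is_phase (diffusivity j \<mu>) \<mu> \<theta>" for \<theta>
    using rep[of \<theta>] that out s by (auto simp: AD branch_def fun_eq_iff)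
  ultimately show ?thesis using that j(1) by blast
qed

end

theorem theorem4p1:
  fixes a :: "real \<Rightarrow> real" and \<sigma> b lam :: real and N :: nat
  assumes "continuous_on UNIV a"
    and "mono a"
    and "\<sigma> > 0"
    and "\<And>t. a t \<ge> \<sigma>"
    and "b > 0"
    and "lam > 0"
    and "a 0 * (real N)\<^sup>2 < lam"
    and "lam \<le> a 0 * (real N + 1)\<^sup>2"
  shows "card (equilibria a b lam) = 2 * N + 1 \<and>
    (\<exists>\<phi>p \<phi>m :: nat \<Rightarrow> real \<Rightarrow> real.
       equilibria a b lam = {\<lambda>x. 0} \<union> (\<phi>p ` {1..N} \<union> \<phi>m ` {1..N}) \<and>
       (\<forall>j\<in>{1..N}.
          card {x \<in> {0..pi}. \<phi>p j x = 0} = j + 1 \<and>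
          card {x \<in> {0..pi}. \<phi>m j x = 0} = j + 1 \<and>
          \<phi>m j = (\<lambda>x. - \<phi>p j x)))"
proof -
  interpret cubic_nonlinearity lam b using assms by unfold_locales
  have pos: "a t > 0" for t using assms(3) assms(4)[of t] by linarith
  have "\<exists>\<mu>. balanced a j \<mu>" if "j \<in> {1..N}" for j
  proof (rule balanced_exists[OF assms(1,3,4)])
    have "a 0 * (real j)\<^sup>2 \<le> a 0 * (real N)\<^sup>2"
      using that pos[of 0] by (intro mult_left_mono power_mono) auto
    then show "a 0 * (real j)\<^sup>2 < lam" using assms(7) by simp
  qed (use that in auto)
  then obtain \<mu> where \<mu>: "\<And>j. j \<in> {1..N} \<Longrightarrow> balanced a j (\<mu> j)" by metis
  have "\<exists>\<theta>. is_phase (diffusivity j (\<mu> j)) (\<mu> j) \<theta>" if "j \<in> {1..N}" for j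
    using phase_exists[of "diffusivity j (\<mu> j)" "\<mu> j"] balanced_length(1)[of a, OF pos \<mu>[OF that]] \<mu>[OF that] that
    by (auto simp: balanced_def)
  then obtain \<theta> where \<theta>: "\<And>j. j \<in> {1..N} \<Longrightarrow> is_phase (diffusivity j (\<mu> j)) (\<mu> j) (\<theta> j)" by metis
  define \<phi>p where "\<phi>p j = branch (\<mu> j) (\<theta> j)" for j
  define \<phi>m where "\<phi>m j = (\<lambda>x. - \<phi>p j x)" for j
  define zeros where "zeros u = card {x \<in> {0..pi}. u x = 0}" for u :: "real \<Rightarrow> real"
  have eq: "\<phi>p j \<in> equilibria a b lam" "\<phi>m j \<in> equilibria a b lam" "zeros (\<phi>p j) = j + 1" "zeros (\<phi>m j) = j + 1"
    if "j \<in> {1..N}" for j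
    using branch_equilibrium[of a, OF pos \<mu>[OF that] _ \<theta>[OF that]] that by (auto simp: \<phi>p_def \<phi>m_def zeros_def)
  \<comment> \<open>The zero function vanishes on an infinite set, whose \<open>card\<close> is 0 by
    convention. This default separates it from the branches, which have \<open>j + 1\<close>
    zeros.\<close>
  have "zeros (\<lambda>x. 0) = card {0..pi}" unfolding zeros_def by (rule arg_cong[where f = card]) auto
  then have zeros0: "zeros (\<lambda>x. 0) = 0" using infinite_Icc[OF pi_gt_zero] by (metis card.infinite)
  have set: "equilibria a b lam = {\<lambda>x. 0} \<union> (\<phi>p ` {1..N} \<union> \<phi>m ` {1..N})"
  proof (intro set_eqI iffI)
    fix u assume u: "u \<in> equilibria a b lam"
    show "u \<in> {\<lambda>x. 0} \<union> (\<phi>p ` {1..N} \<union> \<phi>m ` {1..N})"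
    proof (cases "u = (\<lambda>x. 0)")
      case False
      obtain j \<nu> where j: "j \<ge> 1" "balanced a j \<nu>"
        "\<And>\<theta>. is_phase (diffusivity j \<nu>) \<nu> \<theta> \<Longrightarrow> u = branch \<nu> \<theta> \<or> u = (\<lambda>x. - branch \<nu> \<theta> x)"
        using equilibrium_cases[of a, OF pos u False] by metis
      \<comment> \<open>The strict inequality forced by a balanced parameter meets the nonstrict
        upper bound on \<open>lam\<close>, so \<open>j = N + 1\<close> is excluded even in the case
        of equality.\<close>
      have "a 0 * (real j)\<^sup>2 < a 0 * (real N + 1)\<^sup>2"
        using balanced_imp_less[OF assms(2) j(1,2)] assms(8) by simp
      then have "(real j)\<^sup>2 < (real N + 1)\<^sup>2" using pos[of 0] by simp
      then have "real j < real N + 1" by (rule power2_less_imp_less) simp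
      then have jN: "j \<in> {1..N}" using j(1) by simp
      \<comment> \<open>The parameter is the one already chosen for \<open>j\<close>, and since the
        representation holds for every phase it holds for \<open>\<theta> j\<close>.\<close>
      have "\<nu> = \<mu> j" by (rule balanced_unique[OF assms(2) j(1,2) \<mu>[OF jN]])
      then have "u = \<phi>p j \<or> u = \<phi>m j" using j(3) \<theta>[OF jN] by (simp add: \<phi>p_def \<phi>m_def)
      then show ?thesis using jN by blast
    qed simp
  next
    fix u assume "u \<in> {\<lambda>x. 0} \<union> (\<phi>p ` {1..N} \<union> \<phi>m ` {1..N})"
    then show "u \<in> equilibria a b lam" using eq(1,2) zero_equilibrium[of a, OF pos] by blast
  qed
  \<comment> \<open>The number of zeros recovers \<open>j\<close>.\<close>
  have inj: "inj_on \<phi>p {1..N}" "inj_on \<phi>m {1..N}"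
    using eq(3,4) by (metis add_right_cancel inj_onI)+
  have disj: "\<phi>p ` {1..N} \<inter> \<phi>m ` {1..N} = {}"
  proof (rule ccontr)
    assume "\<phi>p ` {1..N} \<inter> \<phi>m ` {1..N} \<noteq> {}"
    then obtain i j where ij: "i \<in> {1..N}" "j \<in> {1..N}" "\<phi>p i = \<phi>m j" by blast
    \<comment> \<open>Equal zero counts force equal indices, so the branch would be its own negative
      and hence the zero function, whose count is 0.\<close>
    then have "i = j" using eq(3,4) by (metis add_right_cancel)
    then have "\<phi>p i x = - \<phi>p i x" for x using fun_cong[OF ij(3), of x] by (simp add: \<phi>m_def)
    then have "\<phi>p i = (\<lambda>x. 0)" by (auto simp: fun_eq_iff)
    then show False using eq(3)[OF ij(1)] zeros0 by simp
  qed
  have "(\<lambda>x. 0) \<notin> \<phi>p ` {1..N} \<union> \<phi>m ` {1..N}"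
    using eq(3,4) zeros0 by (metis (no_types, lifting) UnE add_is_0 imageE one_neq_zero)
  then have "card (equilibria a b lam) = Suc (card (\<phi>p ` {1..N} \<union> \<phi>m ` {1..N}))" by (simp add: set)
  also have "\<dots> = 2 * N + 1" using inj disj by (simp add: card_Un_disjoint card_image)
  finally show ?thesis using set eq(3,4) unfolding zeros_def by (intro conjI exI[of _ \<phi>p] exI[of _ \<phi>m]) (auto simp: \<phi>m_def)
qed

end
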